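(* Let $F:\mathbb{R}^d\times\mathbb{R}\to\mathbb{R}$ satisfy Assumption (A). Then the spanning problem (P) for $F$ admits a solution $N$ (equivalently $T$) if and only if $F$ is of class AHa. In that case the solution is unique and is given by $N=N^F$, $T=T^F$, i.e. for every $\varphi\in\mathcal{S}_e$, $$T(\varphi)=N(\varphi-\varphi(\mathbf 0))=-\frac{1}{2}\int_{\mathbb{R}^d}\mathcal{F}^{-1}\varphi(\mathbf{x})\Big(\int_{\mathbb{R}}F(\mathbf{x},k)e^{-ik}\,dk\Big)d\mathbf{x}.$$
   Context: Fix $d\ge 1$. For $\mathbf{z}\in\mathbb{R}^q$, $|\mathbf{z}|$ is the Euclidean norm. $\mathcal{S}(\mathbb{R}^q)$ is the Schwartz space (complex-valued). Fourier transform: $\mathcal{F}f(\mathbf{z})=\int_{\mathbb{R}^q}f(\mathbf{s})e^{-i\mathbf{z}\cdot\mathbf{s}}d\mathbf{s}$, inverse $\mathcal{F}^{-1}f(\mathbf{s})=(2\pi)^{-q}\int_{\mathbb{R}^q}f(\mathbf{z})e^{i\mathbf{s}\cdot\mathbf{z}}d\mathbf{z}$; $\mathcal{F}_k[g(\mathbf{x},k)](r)$ denotes the transform in the variable $k$ only. $\mathcal{S}_0$ is the set of functions $\theta_0(\mathbf{x},k)=e^{-irk}h(\mathbf{x})$ on $\mathbb{R}^d\times\mathbb{R}$ with $r\in\mathbb{R}\setminus\{0\}$ and $h\in\mathcal{S}(\mathbb{R}^d)$. $\mathcal{S}_e$ is the space of even functions in $\mathcal{S}(\mathbb{R}^d)$,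 and $\Sigma_e=\{\varphi-\varphi(\mathbf 0):\varphi\in\mathcal{S}_e\}$; the map $\varphi\mapsto\varphi-\varphi(\mathbf 0)$ is a bijection $\mathcal{S}_e\to\Sigma_e$ with inverse $\psi\mapsto\psi-\lim_{|\mathbf{w}|\to\infty}\psi(\mathbf{w})$. Assumption (A): $F(\mathbf{x},k)$ is continuous in $\mathbf{x}$ for each $k$ and continuous in $k$ for each $\mathbf{x}$, and $\int_{\mathbb{R}^d}\int_{\mathbb{R}}|F(\mathbf{x},k)h(\mathbf{x})|\,dk\,d\mathbf{x}<\infty$ for every $h\in\mathcal{S}(\mathbb{R}^d)$. Spanning problem (P): given $F$ satisfying (A), find a linear form $N$ on $\Sigma_e$ such that for every $\theta_0\in\mathcal{S}_0$, $$\int_{\mathbb{R}^d}\int_{\mathbb{R}}F(\mathbf{x},k)\theta_0(\mathbf{x},k)\,dk\,d\mathbf{x}=N\Big(\mathbf{w}\mapsto\int_{\mathbb{R}^d}\int_{\mathbb{R}}(|\mathbf{w}\cdot\mathbf{x}|-|k|)^+\theta_0(\mathbf{x},k)\,dk\,d\mathbf{x}\Big)$$ (the function of $\mathbf{w}$ inside lies in $\Sigma_e$). Equivalently, find a linear form $T$ on $\mathcal{S}_e$ such that $N$ defined by $N(\varphi-\varphi(\mathbf 0)):=T(\varphi)$ solves this. $F$ is of class AHa if $F(\lambda\mathbf{x},\lambda k)=|\lambda|F(\mathbf{x},k)$ for all $\lambda\ne0$ and $F(\mathbf{x},k)=F(\mathbf{x},-k)=F(-\mathbf{x},k)$ for all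 $(\mathbf{x},k)$. For $F$ satisfying (A), $N^F$ and $T^F$ are the linear forms $T^F(\varphi)=N^F(\varphi-\varphi(\mathbf 0)):=-\frac12\int_{\mathbb{R}^d}\mathcal{F}^{-1}\varphi(\mathbf{x})\,\mathcal{F}_k[F(\mathbf{x},k)](1)\,d\mathbf{x}$, $\varphi\in\mathcal{S}_e$. *)

theory Defs
  imports "HOL-Analysis.Analysis"
begin

inductive_set pderivs :: "('a::euclidean_space \<Rightarrow> complex) \<Rightarrow> ('a \<Rightarrow> complex) set"
  for f where
  base: "f \<in> pderivs f"
| step: "g \<in> pderivs f \<Longrightarrow> b \<in> Basis \<Longrightarrow>
           (\<lambda>x. frechet_derivative g (at x) b) \<in> pderivs f"

definition schwartz :: "('a::euclidean_space \<Rightarrow> complex) set" where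
  "schwartz = {f. (\<forall>g\<in>pderivs f. \<forall>x. g differentiable (at x)) \<and>
                  (\<forall>g\<in>pderivs f. \<forall>n::nat. bounded (range (\<lambda>x. (norm x) ^ n * norm (g x))))}"

definition schwartz_even :: "('a::euclidean_space \<Rightarrow> complex) set" where
  "schwartz_even = {f \<in> schwartz. \<forall>x. f (- x) = f x}"

definition Sigma_e :: "('a::euclidean_space \<Rightarrow> complex) set" where
  "Sigma_e = {(\<lambda>w. \<phi> w - \<phi> 0) | \<phi>. \<phi> \<in> schwartz_even}"

definition fourier :: "('a::euclidean_space \<Rightarrow> complex) \<Rightarrow> 'a \<Rightarrow> complex" where
  "fourier f z = (LINT s|lborel. f s * exp (- \<i> * complex_of_real (z \<bullet> s)))"

definition inv_fourier :: "('a::euclidean_space \<Rightarrow> complex) \<Rightarrow> 'a \<Rightarrow> complex" where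
  "inv_fourier f s = complex_of_real ((2 * pi) powr (- real DIM('a))) *
      (LINT z|lborel. f z * exp (\<i> * complex_of_real (s \<bullet> z)))"

definition fourier_k :: "('a \<Rightarrow> real \<Rightarrow> real) \<Rightarrow> 'a \<Rightarrow> real \<Rightarrow> complex" where
  "fourier_k F x r = (LINT k|lborel. complex_of_real (F x k) * exp (- \<i> * complex_of_real (r * k)))"

definition assumption_A :: "('a::euclidean_space \<Rightarrow> real \<Rightarrow> real) \<Rightarrow> bool" where
  "assumption_A F \<longleftrightarrow>
     (\<forall>k. continuous_on UNIV (\<lambda>x. F x k)) \<and>
     (\<forall>x. continuous_on UNIV (\<lambda>k. F x k)) \<and>
     (\<forall>h\<in>(schwartz :: ('a \<Rightarrow> complex) set).
        (\<integral>\<^sup>+x. (\<integral>\<^sup>+k. ennreal (norm (complex_of_real (F x k) * h x)) \<partial>lborel) \<partial>lborel) < \<infinity>)"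

definition AHa :: "('a::euclidean_space \<Rightarrow> real \<Rightarrow> real) \<Rightarrow> bool" where
  "AHa F \<longleftrightarrow>
     (\<forall>c::real. c \<noteq> 0 \<longrightarrow> (\<forall>x k. F (c *\<^sub>R x) (c * k) = \<bar>c\<bar> * F x k)) \<and>
     (\<forall>x k. F x k = F x (- k) \<and> F x k = F (- x) k)"

definition theta0 :: "real \<Rightarrow> ('a \<Rightarrow> complex) \<Rightarrow> 'a \<Rightarrow> real \<Rightarrow> complex" where
  "theta0 r h x k = exp (- \<i> * complex_of_real (r * k)) * h x"

definition linear_form_on :: "('a \<Rightarrow> complex) set \<Rightarrow> (('a \<Rightarrow> complex) \<Rightarrow> complex) \<Rightarrow> bool" where
  "linear_form_on V N \<longleftrightarrow>
     (\<forall>f\<in>V. \<forall>g\<in>V. \<forall>a b::complex. N (\<lambda>w. a * f w + b * g w) = a * N f + b * N g)"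

definition solves_P :: "('a::euclidean_space \<Rightarrow> real \<Rightarrow> real) \<Rightarrow> (('a \<Rightarrow> complex) \<Rightarrow> complex) \<Rightarrow> bool" where
  "solves_P F N \<longleftrightarrow> linear_form_on Sigma_e N \<and>
     (\<forall>r h. r \<noteq> 0 \<longrightarrow> h \<in> schwartz \<longrightarrow>
        (LINT x|lborel. LINT k|lborel. complex_of_real (F x k) * theta0 r h x k) =
        N (\<lambda>w. LINT x|lborel. LINT k|lborel.
               complex_of_real (max 0 (\<bar>w \<bullet> x\<bar> - \<bar>k\<bar>)) * theta0 r h x k))"

definition T_F :: "('a::euclidean_space \<Rightarrow> real \<Rightarrow> real) \<Rightarrow> ('a \<Rightarrow> complex) \<Rightarrow> complex" where
  "T_F F \<phi> = - (1/2) * (LINT x|lborel. inv_fourier \<phi> x * fourier_k F x 1)"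

definition N_F :: "('a::euclidean_space \<Rightarrow> real \<Rightarrow> real) \<Rightarrow> ('a \<Rightarrow> complex) \<Rightarrow> complex" where
  "N_F F \<psi> = T_F F (\<lambda>w. \<psi> w - Lim at_infinity \<psi>)"

end

theory Submission
  imports Defs "HOL-Probability.Probability"
begin

text \<open>
  The substitution \<open>x \<mapsto> x / c\<close>, \<open>k \<mapsto> k / m\<close> with \<open>\<bar>m\<bar> = \<bar>c\<bar>\<close> turns a test function \<open>e\<^sup>-\<^sup>i\<^sup>r\<^sup>k h(x)\<close> into
  another one that spans the same function of \<open>w\<close>. A solution of the spanning problem therefore cannot
  distinguish \<open>F(x, k)\<close> from \<open>F(c x, m k) / \<bar>c\<bar>\<close>, and injectivity of the Fourier transform on
  \<open>L\<^sup>1(\<real>\<^sup>d \<times> \<real>)\<close>, applied to \<open>F\<close> times a Gaussian, makes the two equal everywhere. Conversely, for \<open>F\<close>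
  of class AHa the same substitution reduces the problem to \<open>r = 1\<close>, where the function spanned by \<open>h\<close> is
  \<open>2 \<F>h(0) - \<F>h(w) - \<F>h(-w)\<close>; Fourier inversion on the Schwartz space then identifies the
  solution and shows that its values are forced.
\<close>

section \<open>Integration on Euclidean space\<close>

text \<open>N is a bare linear form on \<open>Sigma_e\<close>, with no continuity, so nothing can be
  approximated inside it: each use of N rests on an exact equality of spanned functions, and all
  limits are taken on the side of F or of the test functions.

  Three features of the data shape the analysis. F need not be integrable, since Assumption (A)
  controls only F times a Schwartz function; hence the Gaussian factor. The test functions exclude r
  = 0, so the transform of a difference of two kernels times that Gaussian is known to vanish only
  off the hyperplane r = 0; the uniqueness theorem therefore has to accept a transform that vanishes
  almost everywhere. F is only separately continuous, so joint measurability needs an argument, and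
  almost everywhere equality is turned into equality in one variable at a time.

  The constant -1/2 comes from symmetrization: if h has transform -phi/2 with phi even, the function
  spanned by h at r = 1 is exactly phi(w) - phi(0).\<close>

lemma lborel_integral_affine:
  fixes f :: "'a::euclidean_space \<Rightarrow> 'b::{banach, second_countable_topology}"
  assumes c: "c \<noteq> 0" and f [measurable]: "f \<in> borel_measurable borel"
  shows "integral\<^sup>L lborel f = \<bar>c\<bar> ^ DIM('a) *\<^sub>R (LINT x|lborel. f (t + c *\<^sub>R x))"
  by (subst lborel_affine[OF c, of t])
     (simp add: integral_density integral_distr)

lemma lborel_integrable_affine:
  fixes f :: "'a::euclidean_space \<Rightarrow> 'b::{banach, second_countable_topology}"
  assumes c: "c \<noteq> 0" and f: "integrable lborel f"
  shows "integrable lborel (\<lambda>x. f (t + c *\<^sub>R x))"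
proof -
  have [measurable]: "f \<in> borel_measurable borel" using f by auto
  have "integrable (density (distr lborel borel (\<lambda>x. t + c *\<^sub>R x)) (\<lambda>_. ennreal (\<bar>c\<bar> ^ DIM('a)))) f"
    using f lborel_affine[OF c, of t] by simp
  then have "integrable lborel (\<lambda>x. \<bar>c\<bar> ^ DIM('a) *\<^sub>R f (t + c *\<^sub>R x))"
    by (simp add: integrable_density integrable_distr_eq)
  then show ?thesis
    using c integrable_scaleR_right[of "inverse (\<bar>c\<bar> ^ DIM('a))"] by fastforce
qed

lemma lborel_nn_integral_affine:
  fixes f :: "'a::euclidean_space \<Rightarrow> ennreal"
  assumes c: "c \<noteq> 0" and f [measurable]: "f \<in> borel_measurable borel"
  shows "integral\<^sup>N lborel f = ennreal (\<bar>c\<bar> ^ DIM('a)) * (\<integral>\<^sup>+x. f (t + c *\<^sub>R x) \<partial>lborel)"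
  by (subst lborel_affine[OF c, of t])
     (simp add: nn_integral_density nn_integral_distr nn_integral_cmult)

lemma lborel_integral_translate:
  fixes f :: "'a::euclidean_space \<Rightarrow> 'b::{banach, second_countable_topology}"
  assumes "f \<in> borel_measurable borel"
  shows "(LINT x|lborel. f (t + x)) = integral\<^sup>L lborel f"
  using lborel_integral_affine[of 1 f t] assms by simp

lemma lborel_integral_uminus:
  fixes f :: "'a::euclidean_space \<Rightarrow> 'b::{banach, second_countable_topology}"
  assumes "f \<in> borel_measurable borel"
  shows "(LINT x|lborel. f (- x)) = integral\<^sup>L lborel f"
  using lborel_integral_affine[of "-1" f 0] assms by simp

section \<open>Product integrals over coordinates and an integrable majorant\<close>

lemma lborel_prod_Basis:
  fixes g :: "'a::euclidean_space \<Rightarrow> real \<Rightarrow> 'b::{real_normed_field, banach, second_countable_topology}"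
  assumes g: "\<And>b. b \<in> Basis \<Longrightarrow> integrable lborel (g b)"
  shows "integrable lborel (\<lambda>x::'a. \<Prod>b\<in>Basis. g b (x \<bullet> b))"
    and "(LINT x::'a|lborel. (\<Prod>b\<in>Basis. g b (x \<bullet> b))) = (\<Prod>b\<in>Basis. integral\<^sup>L lborel (g b))"
proof -
  interpret product_sigma_finite "\<lambda>_::'a. lborel :: real measure" ..
  have [measurable]: "b \<in> Basis \<Longrightarrow> g b \<in> borel_measurable borel" for b
    using g[of b] by auto
  have *: "(\<Sum>b\<in>Basis. f b *\<^sub>R b) \<bullet> c = f c" if "c \<in> Basis" for f :: "'a \<Rightarrow> real" and c
    using that by simp
  show "integrable lborel (\<lambda>x::'a. \<Prod>b\<in>Basis. g b (x \<bullet> b))"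
    by (subst lborel_eq, subst integrable_distr_eq) (auto simp: * intro!: product_integrable_prod g cong: prod.cong)
  show "(LINT x::'a|lborel. (\<Prod>b\<in>Basis. g b (x \<bullet> b))) = (\<Prod>b\<in>Basis. integral\<^sup>L lborel (g b))"
    by (subst lborel_eq, subst integral_distr)
       (auto simp: * intro!: product_integral_prod g cong: prod.cong)
qed

lemma prod_Basis_le_norm_power:
  fixes x :: "'a::euclidean_space"
  shows "(\<Prod>b\<in>Basis. 1 + (x \<bullet> b)\<^sup>2) \<le> (1 + (norm x)\<^sup>2) ^ DIM('a)"
proof -
  have "(x \<bullet> b)\<^sup>2 \<le> (norm x)\<^sup>2" if "b \<in> Basis" for b
    using power_mono[OF Basis_le_norm[OF that, of x], of 2] by simp
  then have "(\<Prod>b\<in>Basis. 1 + (x \<bullet> b)\<^sup>2) \<le> (\<Prod>b\<in>(Basis::'a set). 1 + (norm x)\<^sup>2)"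
    by (intro prod_mono) auto
  then show ?thesis by simp
qed

text \<open>The exponent \<open>DIM('a)\<close> gives one factor per coordinate: each 1 + (x . b)^2
  is at most 1 + |x|^2, so the function is dominated by a product of one-dimensional integrable
  functions 1 / (1 + t^2). No polar coordinates are involved.\<close>

lemma integrable_inverse_1_plus_norm:
  "integrable lborel (\<lambda>x::'a::euclidean_space. inverse ((1 + (norm x)\<^sup>2) ^ DIM('a)))"
proof (rule Bochner_Integration.integrable_bound)
  have 1: "integrable lborel (\<lambda>x::real. inverse (1 + x\<^sup>2))"
    using integrable_inverse_1_plus_square
    by (simp add: set_integrable_def)
  show "integrable lborel (\<lambda>x::'a. \<Prod>b\<in>Basis. inverse (1 + (x \<bullet> b)\<^sup>2))"
    using lborel_prod_Basis(1)[of "\<lambda>b x. inverse (1 + x\<^sup>2)"] 1 by blast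
  show "AE x in lborel. norm (inverse ((1 + (norm x)\<^sup>2) ^ DIM('a)))
          \<le> norm (\<Prod>b\<in>Basis. inverse (1 + ((x::'a) \<bullet> b)\<^sup>2))"
  proof (rule AE_I2)
    fix x :: 'a
    have p: "0 < (\<Prod>b\<in>Basis. 1 + (x \<bullet> b)\<^sup>2)"
      by (intro prod_pos) (auto simp: add_pos_nonneg)
    have "inverse ((1 + (norm x)\<^sup>2) ^ DIM('a)) \<le> inverse (\<Prod>b\<in>Basis. 1 + (x \<bullet> b)\<^sup>2)"
      using prod_Basis_le_norm_power[of x] p by (intro le_imp_inverse_le) auto
    also have "\<dots> = (\<Prod>b\<in>Basis. inverse (1 + (x \<bullet> b)\<^sup>2))"
      by (simp add: prod_inversef[symmetric] comp_def)
    finally show "norm (inverse ((1 + (norm x)\<^sup>2) ^ DIM('a)))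
          \<le> norm (\<Prod>b\<in>Basis. inverse (1 + (x \<bullet> b)\<^sup>2))"
      by (simp add: abs_prod)
  qed
qed auto


section \<open>Schwartz functions\<close>

text \<open>Decay of the function alone, without its derivatives. Smoothness is handled separately
  by \<open>schwartzI\<close>, which asks for this decay on every member of a set closed under
  differentiation.\<close>

definition rapidly_decreasing :: "('a::euclidean_space \<Rightarrow> complex) \<Rightarrow> bool" where
  "rapidly_decreasing f \<longleftrightarrow> (\<forall>n. \<exists>C. \<forall>x. norm x ^ n * norm (f x) \<le> C)"

lemma rapidly_decreasing_iff_bounded:
  "rapidly_decreasing f \<longleftrightarrow> (\<forall>n. bounded (range (\<lambda>x. norm x ^ n * norm (f x))))"
  unfolding rapidly_decreasing_def bounded_iff by simp

lemma rapidly_decreasingE: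
  assumes "rapidly_decreasing f"
  obtains C where "C \<ge> 0" "\<And>x. norm x ^ n * norm (f x) \<le> C"
proof -
  obtain C where "\<And>x. norm x ^ n * norm (f x) \<le> C"
    using assms unfolding rapidly_decreasing_def by blast
  then show ?thesis
    using that[of "max 0 C"] by (simp add: le_max_iff_disj)
qed

lemma rapidly_decreasing_lincomb:
  assumes "rapidly_decreasing f" "rapidly_decreasing g"
  shows "rapidly_decreasing (\<lambda>x. a * f x + b * g x)"
  unfolding rapidly_decreasing_def
proof
  fix n
  obtain C where C: "C \<ge> 0" "\<And>x. norm x ^ n * norm (f x) \<le> C"
    using rapidly_decreasingE[OF assms(1), of n] by blast
  obtain D where D: "D \<ge> 0" "\<And>x. norm x ^ n * norm (g x) \<le> D"
    using rapidly_decreasingE[OF assms(2), of n] by blast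
  have "norm x ^ n * norm (a * f x + b * g x) \<le> norm a * C + norm b * D" for x
  proof -
    have "norm x ^ n * norm (a * f x + b * g x) \<le> norm x ^ n * (norm a * norm (f x) + norm b * norm (g x))"
      by (intro mult_left_mono order_trans[OF norm_triangle_ineq]) (auto simp: norm_mult)
    also have "\<dots> = norm a * (norm x ^ n * norm (f x)) + norm b * (norm x ^ n * norm (g x))"
      by (simp add: algebra_simps)
    also have "\<dots> \<le> norm a * C + norm b * D"
      by (intro add_mono mult_left_mono C D) auto
    finally show ?thesis .
  qed
  then show "\<exists>C. \<forall>x. norm x ^ n * norm (a * f x + b * g x) \<le> C" by blast
qed

lemma rapidly_decreasing_scale:
  assumes "rapidly_decreasing f" "c \<noteq> 0"
  shows "rapidly_decreasing (\<lambda>x. f (c *\<^sub>R x))"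
  unfolding rapidly_decreasing_def
proof
  fix n
  obtain C where C: "C \<ge> 0" "\<And>x. norm x ^ n * norm (f x) \<le> C"
    using rapidly_decreasingE[OF assms(1), of n] by blast
  have "norm x ^ n * norm (f (c *\<^sub>R x)) \<le> C / \<bar>c\<bar> ^ n" for x
    using C(2)[of "c *\<^sub>R x"] assms(2) by (simp add: field_simps power_mult_distrib)
  then show "\<exists>C. \<forall>x. norm x ^ n * norm (f (c *\<^sub>R x)) \<le> C" by blast
qed

lemma rapidly_decreasing_inner_mult:
  assumes "rapidly_decreasing f"
  shows "rapidly_decreasing (\<lambda>x. complex_of_real (x \<bullet> v) * f x)"
  unfolding rapidly_decreasing_def
proof
  fix n
  obtain C where C: "C \<ge> 0" "\<And>x. norm x ^ Suc n * norm (f x) \<le> C"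
    using rapidly_decreasingE[OF assms(1), of "Suc n"] by blast
  have "norm x ^ n * norm (complex_of_real (x \<bullet> v) * f x) \<le> norm v * C" for x
  proof -
    have "norm x ^ n * norm (complex_of_real (x \<bullet> v) * f x) \<le> norm x ^ n * ((norm x * norm v) * norm (f x))"
      using Cauchy_Schwarz_ineq2[of x v]
      by (intro mult_left_mono) (auto simp: norm_mult intro: mult_right_mono)
    also have "\<dots> = norm v * (norm x ^ Suc n * norm (f x))" by simp
    also have "\<dots> \<le> norm v * C" by (intro mult_left_mono C) auto
    finally show ?thesis .
  qed
  then show "\<exists>C. \<forall>x. norm x ^ n * norm (complex_of_real (x \<bullet> v) * f x) \<le> C" by blast
qed

lemma one_plus_square_power_le: "(1 + t\<^sup>2) ^ m \<le> 2 ^ m * (1 + t ^ (2 * m))" for t :: real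
proof -
  have "(1 + t\<^sup>2) ^ m \<le> (2 * max 1 (t\<^sup>2)) ^ m"
    by (intro power_mono) auto
  also have "\<dots> = 2 ^ m * (max 1 (t\<^sup>2)) ^ m" by (simp add: power_mult_distrib)
  also have "(max 1 (t\<^sup>2)) ^ m \<le> 1 + t ^ (2 * m)"
    by (auto simp: max_def power_mult)
  finally show ?thesis by simp
qed

text \<open>The bounds for the powers 0 and 2m combine into a single majorant, which is integrable
  when m is the dimension.\<close>

lemma rapidly_decreasing_bound:
  assumes "rapidly_decreasing f"
  obtains C where "C \<ge> 0" "\<And>x. norm (f x) \<le> C * inverse ((1 + (norm x)\<^sup>2) ^ m)"
proof -
  obtain C where C: "C \<ge> 0" "\<And>x. norm x ^ 0 * norm (f x) \<le> C"
    using rapidly_decreasingE[OF assms(1), of 0] by blast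
  obtain D where D: "D \<ge> 0" "\<And>x. norm x ^ (2*m) * norm (f x) \<le> D"
    using rapidly_decreasingE[OF assms(1), of "2*m"] by blast
  have "norm (f x) \<le> 2 ^ m * (C + D) * inverse ((1 + (norm x)\<^sup>2) ^ m)" for x
  proof -
    have "norm (f x) * (1 + (norm x)\<^sup>2) ^ m \<le> norm (f x) * (2 ^ m * (1 + norm x ^ (2 * m)))"
      by (intro mult_left_mono one_plus_square_power_le) auto
    also have "\<dots> = 2 ^ m * (norm x ^ 0 * norm (f x) + norm x ^ (2*m) * norm (f x))"
      by (simp add: algebra_simps)
    also have "\<dots> \<le> 2 ^ m * (C + D)"
      by (intro mult_left_mono add_mono C D) auto
    finally show ?thesis
      by (simp add: field_simps add_pos_nonneg)
  qed
  then show ?thesis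
    using C D by (intro that[of "2 ^ m * (C + D)"]) auto
qed

lemma rapidly_decreasing_integrable:
  fixes f :: "'a::euclidean_space \<Rightarrow> complex"
  assumes f: "rapidly_decreasing f" and [measurable]: "f \<in> borel_measurable borel"
  shows "integrable lborel f"
proof -
  obtain C where C: "C \<ge> 0" "\<And>x. norm (f x) \<le> C * inverse ((1 + (norm x)\<^sup>2) ^ DIM('a))"
    using rapidly_decreasing_bound[OF f, of "DIM('a)"] by blast
  have "norm (f x) \<le> norm (C * inverse ((1 + (norm x)\<^sup>2) ^ DIM('a)))" for x
    using order_trans[OF C(2)[of x] abs_ge_self] unfolding real_norm_def .
  then show ?thesis
    by (intro Bochner_Integration.integrable_bound[OF
          integrable_mult_right[OF integrable_inverse_1_plus_norm, of C]]) auto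
qed

section \<open>Membership in the Schwartz space and its closure properties\<close>

lemma pderivs_trans: "h \<in> pderivs g \<Longrightarrow> g \<in> pderivs f \<Longrightarrow> h \<in> pderivs f"
  by (induction rule: pderivs.induct) (auto intro: pderivs.intros)

text \<open>An invariant set S replaces the computation of iterated derivatives: it contains all of
  \<open>pderivs f\<close> as soon as it contains f and is closed under one partial derivative. Each
  closure property below amounts to guessing a suitable S.\<close>

lemma schwartzI:
  assumes "f \<in> S"
    and "\<And>g x. g \<in> S \<Longrightarrow> g differentiable (at x)"
    and "\<And>g. g \<in> S \<Longrightarrow> rapidly_decreasing g"
    and "\<And>g b. g \<in> S \<Longrightarrow> b \<in> Basis \<Longrightarrow> (\<lambda>x. frechet_derivative g (at x) b) \<in> S"
  shows "f \<in> schwartz"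
proof -
  have "g \<in> S" if "g \<in> pderivs f" for g
    using that by induction (auto intro: assms)
  then show ?thesis
    using assms unfolding schwartz_def rapidly_decreasing_iff_bounded by auto
qed

lemma schwartz_differentiable: "f \<in> schwartz \<Longrightarrow> f differentiable (at x)"
  unfolding schwartz_def by (auto intro: pderivs.base)

lemma schwartz_rapidly_decreasing: "f \<in> schwartz \<Longrightarrow> rapidly_decreasing f"
  unfolding schwartz_def rapidly_decreasing_iff_bounded by (auto intro: pderivs.base)

lemma schwartz_pderiv:
  assumes "f \<in> schwartz" "b \<in> Basis"
  shows "(\<lambda>x. frechet_derivative f (at x) b) \<in> schwartz"
proof -
  have "(\<lambda>x. frechet_derivative f (at x) b) \<in> pderivs f"
    using assms by (auto intro: pderivs.intros)
  then show ?thesis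
    using assms(1) pderivs_trans unfolding schwartz_def by blast
qed

lemma schwartz_has_derivative:
  "f \<in> schwartz \<Longrightarrow> (f has_derivative frechet_derivative f (at x)) (at x)"
  using schwartz_differentiable frechet_derivative_works by blast

lemma schwartz_continuous_on: "f \<in> schwartz \<Longrightarrow> continuous_on A f"
  by (meson continuous_at_imp_continuous_on differentiable_imp_continuous_within schwartz_differentiable)

lemma schwartz_measurable: "f \<in> schwartz \<Longrightarrow> f \<in> borel_measurable borel"
  by (simp add: schwartz_continuous_on borel_measurable_continuous_onI)

lemma schwartz_integrable: "f \<in> schwartz \<Longrightarrow> integrable lborel f"
  by (intro rapidly_decreasing_integrable schwartz_rapidly_decreasing schwartz_measurable)

lemma frechet_derivative_eq:
  assumes "\<And>x. (f has_derivative f' x) (at x)"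
  shows "(\<lambda>x. frechet_derivative f (at x) b) = (\<lambda>x. f' x b)"
  using frechet_derivative_at[OF assms] by metis

lemma schwartz_lincomb:
  assumes f: "f \<in> schwartz" and g: "g \<in> schwartz"
  shows "(\<lambda>x. \<alpha> * f x + \<beta> * g x) \<in> schwartz"
proof -
  define S where "S = {(\<lambda>x. \<alpha> * f x + \<beta> * g x) | f g. f \<in> schwartz \<and> g \<in> (schwartz :: ('a \<Rightarrow> complex) set)}"
  have D: "((\<lambda>x. \<alpha> * f x + \<beta> * g x) has_derivative
      (\<lambda>v. \<alpha> * frechet_derivative f (at x) v + \<beta> * frechet_derivative g (at x) v)) (at x)"
    if "f \<in> schwartz" "g \<in> schwartz" for f g :: "'a \<Rightarrow> complex" and x
    using that by (auto intro!: derivative_eq_intros schwartz_has_derivative)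
  show ?thesis
  proof (rule schwartzI[of _ S])
    show "(\<lambda>x. \<alpha> * f x + \<beta> * g x) \<in> S" using f g by (auto simp: S_def)
  next
    fix h x assume "h \<in> S" then show "h differentiable at x"
      unfolding S_def using D differentiable_def by blast
  next
    fix h assume "h \<in> S" then show "rapidly_decreasing h"
      unfolding S_def using rapidly_decreasing_lincomb schwartz_rapidly_decreasing by blast
  next
    fix h and b :: 'a assume "h \<in> S" and b: "b \<in> Basis"
    then obtain f g where fg: "h = (\<lambda>x. \<alpha> * f x + \<beta> * g x)" "f \<in> schwartz" "g \<in> schwartz"
      unfolding S_def by blast
    have "(\<lambda>x. frechet_derivative h (at x) b) =
        (\<lambda>x. \<alpha> * frechet_derivative f (at x) b + \<beta> * frechet_derivative g (at x) b)"
      unfolding fg(1) by (rule frechet_derivative_eq) (rule D[OF fg(2,3)])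
    then show "(\<lambda>x. frechet_derivative h (at x) b) \<in> S"
      unfolding S_def mem_Collect_eq
      by (intro exI[of _ "\<lambda>x. frechet_derivative f (at x) b"] exI[of _ "\<lambda>x. frechet_derivative g (at x) b"]
          conjI schwartz_pderiv[OF fg(2) b] schwartz_pderiv[OF fg(3) b])
  qed
qed

lemma schwartz_cmult: "f \<in> schwartz \<Longrightarrow> (\<lambda>x. \<alpha> * f x) \<in> schwartz"
  using schwartz_lincomb[of f f \<alpha> 0] by simp

lemma schwartz_scale:
  assumes f: "f \<in> schwartz" and c: "c \<noteq> 0"
  shows "(\<lambda>x. f (c *\<^sub>R x)) \<in> schwartz"
proof -
  define S where "S = {(\<lambda>x. f (c *\<^sub>R x)) | f. f \<in> (schwartz :: ('a \<Rightarrow> complex) set)}"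
  have D: "((\<lambda>x. f (c *\<^sub>R x)) has_derivative
      (\<lambda>v. frechet_derivative f (at (c *\<^sub>R x)) (c *\<^sub>R v))) (at x)"
    if "f \<in> schwartz" for f :: "'a \<Rightarrow> complex" and x
  proof -
    have "((\<lambda>x. c *\<^sub>R x) has_derivative (\<lambda>v. c *\<^sub>R v)) (at x)"
      by (auto intro!: derivative_eq_intros)
    from has_derivative_compose[OF this schwartz_has_derivative[OF that]] show ?thesis .
  qed
  show ?thesis
  proof (rule schwartzI[of _ S])
    show "(\<lambda>x. f (c *\<^sub>R x)) \<in> S" using f by (auto simp: S_def)
  next
    fix h x assume "h \<in> S" then show "h differentiable at x"
      unfolding S_def using D differentiable_def by blast
  next
    fix h assume "h \<in> S" then show "rapidly_decreasing h"
      unfolding S_def using rapidly_decreasing_scale[OF schwartz_rapidly_decreasing c] by blast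
  next
    fix h and b :: 'a assume "h \<in> S" and b: "b \<in> Basis"
    then obtain f where fg: "h = (\<lambda>x. f (c *\<^sub>R x))" "f \<in> schwartz"
      unfolding S_def by blast
    have "(\<lambda>x. frechet_derivative h (at x) b) = (\<lambda>x. frechet_derivative f (at (c *\<^sub>R x)) (c *\<^sub>R b))"
      unfolding fg(1) by (rule frechet_derivative_eq) (rule D[OF fg(2)])
    \<comment> \<open>The chain-rule factor c is absorbed into the inner Schwartz function, so the
      set S of dilated Schwartz functions is already closed.\<close>
    also have "\<dots> = (\<lambda>x. complex_of_real c * frechet_derivative f (at (c *\<^sub>R x)) b)"
      using linear_frechet_derivative[OF schwartz_differentiable[OF fg(2)]]
      by (simp add: linear_scale scaleR_conv_of_real)
    finally show "(\<lambda>x. frechet_derivative h (at x) b) \<in> S"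
      unfolding S_def mem_Collect_eq
      by (intro exI[of _ "\<lambda>x. complex_of_real c * frechet_derivative f (at x) b"] conjI
          schwartz_cmult schwartz_pderiv[OF fg(2) b]) simp
  qed
qed

text \<open>Products (x . v) f alone are not closed under differentiation, because the product rule
  leaves the term (b . v) f. Adding a free Schwartz summand g to the members of S absorbs
  it.\<close>

lemma schwartz_inner_mult:
  assumes f: "f \<in> schwartz"
  shows "(\<lambda>x. complex_of_real (x \<bullet> v) * f x) \<in> schwartz"
proof -
  define S where "S = {(\<lambda>x. complex_of_real (x \<bullet> v) * f x + g x) | f g.
      f \<in> schwartz \<and> g \<in> (schwartz :: ('a \<Rightarrow> complex) set)}"
  have D: "((\<lambda>x. complex_of_real (x \<bullet> v) * f x + g x) has_derivative
      (\<lambda>u. complex_of_real (x \<bullet> v) * frechet_derivative f (at x) u +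
         (complex_of_real (u \<bullet> v) * f x + frechet_derivative g (at x) u))) (at x)"
    if "f \<in> schwartz" "g \<in> schwartz" for f g :: "'a \<Rightarrow> complex" and x
    using that by (auto intro!: derivative_eq_intros schwartz_has_derivative)
  show ?thesis
  proof (rule schwartzI[of _ S])
    have "(\<lambda>x. complex_of_real (x \<bullet> v) * f x + 0 * f x) \<in> S"
      unfolding S_def mem_Collect_eq
      by (intro exI[of _ f] exI[of _ "\<lambda>x. 0 * f x"] conjI refl f schwartz_cmult)
    then show "(\<lambda>x. complex_of_real (x \<bullet> v) * f x) \<in> S" by simp
  next
    fix h x assume "h \<in> S" then show "h differentiable at x"
      unfolding S_def using D differentiable_def by blast
  next
    fix h assume "h \<in> S" 
    then obtain f g where fg: "h = (\<lambda>x. complex_of_real (x \<bullet> v) * f x + g x)" "f \<in> schwartz" "g \<in> schwartz"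
      unfolding S_def by blast
    then show "rapidly_decreasing h"
      using rapidly_decreasing_lincomb[OF rapidly_decreasing_inner_mult[OF schwartz_rapidly_decreasing]
          schwartz_rapidly_decreasing, of f g 1 v 1] by simp
  next
    fix h and b :: 'a assume "h \<in> S" and b: "b \<in> Basis"
    then obtain f g where fg: "h = (\<lambda>x. complex_of_real (x \<bullet> v) * f x + g x)" "f \<in> schwartz" "g \<in> schwartz"
      unfolding S_def by blast
    have "(\<lambda>x. frechet_derivative h (at x) b) =
        (\<lambda>x. complex_of_real (x \<bullet> v) * frechet_derivative f (at x) b +
           (complex_of_real (b \<bullet> v) * f x + frechet_derivative g (at x) b))"
      unfolding fg(1) by (rule frechet_derivative_eq) (rule D[OF fg(2,3)])
    moreover have "(\<lambda>x. complex_of_real (b \<bullet> v) * f x + frechet_derivative g (at x) b) \<in> schwartz"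
      using schwartz_lincomb[OF fg(2) schwartz_pderiv[OF fg(3) b], of "complex_of_real (b \<bullet> v)" 1] by simp
    ultimately show "(\<lambda>x. frechet_derivative h (at x) b) \<in> S"
      unfolding S_def mem_Collect_eq
      by (intro exI[of _ "\<lambda>x. frechet_derivative f (at x) b"]
          exI[of _ "\<lambda>x. complex_of_real (b \<bullet> v) * f x + frechet_derivative g (at x) b"]
          conjI schwartz_pderiv[OF fg(2) b])
  qed
qed

text \<open>If the partial derivatives of \<open>E\<close> are polynomial multiples of \<open>E\<close>, this set is closed under
  differentiation, so only the decay of \<open>E\<close> itself needs an estimate.\<close>

inductive_set inner_mult_span :: "('a::euclidean_space \<Rightarrow> complex) \<Rightarrow> ('a \<Rightarrow> complex) set"
  for E where
  base: "E \<in> inner_mult_span E"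
| lincomb: "f \<in> inner_mult_span E \<Longrightarrow> g \<in> inner_mult_span E \<Longrightarrow>
    (\<lambda>x. \<alpha> * f x + \<beta> * g x) \<in> inner_mult_span E"
| inner_mult: "f \<in> inner_mult_span E \<Longrightarrow>
    (\<lambda>x. complex_of_real (x \<bullet> v) * f x) \<in> inner_mult_span E"

section \<open>Gaussians times plane waves as Schwartz functions\<close>

definition modulated_gaussian :: "'a::euclidean_space \<Rightarrow> 'a \<Rightarrow> complex" where
  "modulated_gaussian \<xi> x = exp (- complex_of_real (x \<bullet> x) / 2 + \<i> * complex_of_real (x \<bullet> \<xi>))"

lemma norm_modulated_gaussian: "norm (modulated_gaussian \<xi> x) = exp (- (norm x)\<^sup>2 / 2)"
  by (simp add: modulated_gaussian_def power2_norm_eq_inner)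

text \<open>Raise y/n <= exp(y/n) to the power n. The crude constant n^n suffices, since only
  boundedness is wanted.\<close>

lemma power_le_exp: "y ^ n \<le> real n ^ n * exp y" if "y \<ge> 0" for y :: real
proof (cases "n = 0")
  case False
  have "y / real n \<le> exp (y / real n)"
    using exp_ge_add_one_self[of "y / real n"] by linarith
  then have "(y / real n) ^ n \<le> exp (y / real n) ^ n"
    using that by (intro power_mono) auto
  also have "\<dots> = exp y"
    using False by (simp add: exp_of_nat_mult[symmetric])
  finally show ?thesis
    using False by (simp add: field_simps power_divide)
qed (use that in simp)

lemma rapidly_decreasing_modulated_gaussian: "rapidly_decreasing (modulated_gaussian \<xi>)"
  unfolding rapidly_decreasing_def
proof
  fix n
  have "norm x ^ n * norm (modulated_gaussian \<xi> x) \<le> real n ^ n * exp (1 / 2)" for x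
  proof -
    \<comment> \<open>Completing the square: (|x| - 1)^2 >= 0. The Gaussian thus absorbs the factor
      exp(|x|) that bounds the power of |x|.\<close>
    have "norm x - (norm x)\<^sup>2 / 2 \<le> 1 / 2"
      using zero_le_power2[of "norm x - 1"] by (simp add: power2_eq_square algebra_simps)
    then have le: "exp (norm x + - (norm x)\<^sup>2 / 2) \<le> exp (1 / 2)" by simp
    have "norm x ^ n * norm (modulated_gaussian \<xi> x) \<le>
        (real n ^ n * exp (norm x)) * exp (- (norm x)\<^sup>2 / 2)"
      unfolding norm_modulated_gaussian by (intro mult_right_mono power_le_exp) auto
    also have "\<dots> = real n ^ n * exp (norm x + - (norm x)\<^sup>2 / 2)"
      by (simp add: exp_add[symmetric])
    also have "\<dots> \<le> real n ^ n * exp (1 / 2)" using le by (intro mult_left_mono) auto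
    finally show ?thesis .
  qed
  then show "\<exists>C. \<forall>x. norm x ^ n * norm (modulated_gaussian \<xi> x) \<le> C" by blast
qed

lemma modulated_gaussian_has_derivative:
  "(modulated_gaussian \<xi> has_derivative
     (\<lambda>v. (- complex_of_real (x \<bullet> v) + \<i> * complex_of_real (v \<bullet> \<xi>)) * modulated_gaussian \<xi> x)) (at x)"
proof -
  have "((\<lambda>x. - complex_of_real (x \<bullet> x) / 2 + \<i> * complex_of_real (x \<bullet> \<xi>)) has_derivative
      (\<lambda>v. - complex_of_real (x \<bullet> v + v \<bullet> x) / 2 + \<i> * complex_of_real (v \<bullet> \<xi>))) (at x)"
    by (auto intro!: derivative_eq_intros simp: fun_eq_iff field_simps)
  from has_derivative_compose[OF this DERIV_exp[unfolded has_field_derivative_def]] show ?thesis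
    unfolding modulated_gaussian_def[abs_def]
  proof (rule has_derivative_eq_rhs, intro ext)
    fix v
    have "complex_of_real (x \<bullet> v + v \<bullet> x) = 2 * complex_of_real (x \<bullet> v)"
      by (subst inner_commute[of v x]) simp
    then show "exp (- complex_of_real (x \<bullet> x) / 2 + \<i> * complex_of_real (x \<bullet> \<xi>)) *
          (- complex_of_real (x \<bullet> v + v \<bullet> x) / 2 + \<i> * complex_of_real (v \<bullet> \<xi>)) =
        (- complex_of_real (x \<bullet> v) + \<i> * complex_of_real (v \<bullet> \<xi>)) *
          exp (- complex_of_real (x \<bullet> x) / 2 + \<i> * complex_of_real (x \<bullet> \<xi>))"
      by simp
  qed
qed

text \<open>A derivative and the membership of its basis values are produced together, because the
  product rule for the next member needs the derivative already found for the previous one.\<close>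

lemma inner_mult_span_pderiv:
  assumes E: "\<And>x. (E has_derivative E' x) (at x)"
    and E': "\<And>b. b \<in> Basis \<Longrightarrow> (\<lambda>x. E' x b) \<in> inner_mult_span E"
    and f: "f \<in> inner_mult_span E"
  shows "\<exists>f'. (\<forall>x. (f has_derivative f' x) (at x)) \<and>
              (\<forall>b\<in>Basis. (\<lambda>x. f' x b) \<in> inner_mult_span E)"
  using f
proof induction
  case base
  then show ?case using E E' by blast
next
  case (lincomb f g \<alpha> \<beta>)
  then obtain f' g' where fg: "\<And>x. (f has_derivative f' x) (at x)" "\<And>x. (g has_derivative g' x) (at x)"
    "\<And>b. b \<in> Basis \<Longrightarrow> (\<lambda>x. f' x b) \<in> inner_mult_span E"
    "\<And>b. b \<in> Basis \<Longrightarrow> (\<lambda>x. g' x b) \<in> inner_mult_span E" by blast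
  have "((\<lambda>x. \<alpha> * f x + \<beta> * g x) has_derivative (\<lambda>v. \<alpha> * f' x v + \<beta> * g' x v)) (at x)" for x
    using fg by (auto intro!: derivative_eq_intros)
  then show ?case
    using inner_mult_span.lincomb[OF fg(3,4)] 
    by (intro exI[of _ "\<lambda>x v. \<alpha> * f' x v + \<beta> * g' x v"]) auto
next
  case (inner_mult f v)
  then obtain f' where f': "\<And>x. (f has_derivative f' x) (at x)"
    "\<And>b. b \<in> Basis \<Longrightarrow> (\<lambda>x. f' x b) \<in> inner_mult_span E" by blast
  \<comment> \<open>The factor 1 gives the product rule the literal shape of the
    \<open>lincomb\<close> rule.\<close>
  have "((\<lambda>x. complex_of_real (x \<bullet> v) * f x) has_derivative
      (\<lambda>u. complex_of_real (u \<bullet> v) * f x + 1 * (complex_of_real (x \<bullet> v) * f' x u))) (at x)" for x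
    using f' by (auto intro!: derivative_eq_intros)
  then show ?case
    by (intro exI[of _ "\<lambda>x u. complex_of_real (u \<bullet> v) * f x + 1 * (complex_of_real (x \<bullet> v) * f' x u)"]
          conjI allI ballI inner_mult_span.lincomb[OF inner_mult.hyps inner_mult_span.inner_mult[OF f'(2)]])
qed

text \<open>These are the test functions h of the injectivity argument: the Gaussian secures
  integrability, and the plane wave turns a pairing into a value of a Fourier transform in
  x.\<close>

lemma modulated_gaussian_schwartz: "modulated_gaussian \<xi> \<in> schwartz"
proof -
  define S where "S = inner_mult_span (modulated_gaussian \<xi>)"
  have "\<exists>f'. (\<forall>x. (f has_derivative f' x) (at x)) \<and> (\<forall>b\<in>Basis. (\<lambda>x. f' x b) \<in> S)"
    if "f \<in> S" for f
    unfolding S_def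
  proof (rule inner_mult_span_pderiv[OF modulated_gaussian_has_derivative])
    fix b :: 'a
    have "(\<lambda>x. (- 1) * (complex_of_real (x \<bullet> b) * modulated_gaussian \<xi> x) +
        (\<i> * complex_of_real (b \<bullet> \<xi>)) * modulated_gaussian \<xi> x) \<in> inner_mult_span (modulated_gaussian \<xi>)"
      by (intro inner_mult_span.intros)
    then show "(\<lambda>x. (- complex_of_real (x \<bullet> b) + \<i> * complex_of_real (b \<bullet> \<xi>)) * modulated_gaussian \<xi> x)
       \<in> inner_mult_span (modulated_gaussian \<xi>)"
      by (simp add: algebra_simps)
  qed (use that S_def in simp)
  note D = this
  show ?thesis
  proof (rule schwartzI[of _ S])
    show "modulated_gaussian \<xi> \<in> S" unfolding S_def by (rule inner_mult_span.base)
  next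
    fix f and x :: 'a assume "f \<in> S" then show "f differentiable at x"
      using D differentiable_def by blast
  next
    fix f and b :: 'a assume f: "f \<in> S" and b: "b \<in> Basis"
    obtain f' where f': "\<And>x. (f has_derivative f' x) (at x)" "\<And>b. b \<in> Basis \<Longrightarrow> (\<lambda>x. f' x b) \<in> S"
      using D[OF f] by blast
    show "(\<lambda>x. frechet_derivative f (at x) b) \<in> S"
      unfolding frechet_derivative_eq[OF f'(1)] by (rule f'(2)[OF b])
  next
    fix f assume "f \<in> S" then show "rapidly_decreasing f"
      unfolding S_def
      by induction (fact rapidly_decreasing_modulated_gaussian
          | erule (1) rapidly_decreasing_lincomb | erule rapidly_decreasing_inner_mult)+
  qed
qed


section \<open>The Fourier transform of integrable functions\<close>

lemma measurable_cis [measurable]: "cis \<in> borel_measurable borel"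
  by (intro borel_measurable_continuous_onI continuous_intros)

lemma fourier_cis: "fourier f z = (LINT s|lborel. f s * cis (- (z \<bullet> s)))"
  unfolding fourier_def cis_conv_exp by simp

lemma inv_fourier_cis:
  "inv_fourier f s = complex_of_real ((2 * pi) powr (- real DIM('a))) * (LINT z|lborel. f z * cis (s \<bullet> z))"
  for f :: "'a::euclidean_space \<Rightarrow> complex"
  unfolding inv_fourier_def cis_conv_exp by simp

lemma inv_fourier_eq_fourier:
  "inv_fourier f s = complex_of_real ((2 * pi) powr (- real DIM('a))) * fourier f (- s)"
  for f :: "'a::euclidean_space \<Rightarrow> complex"
  unfolding inv_fourier_cis fourier_cis by simp

lemma integrable_mult_cis:
  fixes f :: "'b \<Rightarrow> complex"
  assumes "integrable M f" "g \<in> borel_measurable M"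
  shows "integrable M (\<lambda>x. f x * cis (g x))"
  using assms by (intro Bochner_Integration.integrable_bound[OF assms(1)]) (auto simp: norm_mult)

lemma norm_fourier_le: "norm (fourier f z) \<le> (LINT x|lborel. norm (f x))"
  unfolding fourier_cis
  by (rule order_trans[OF integral_norm_bound]) (simp add: norm_mult)

section \<open>Fourier integrals of Gaussians\<close>

lemma modulated_gaussian_cis:
  "modulated_gaussian \<xi> x = complex_of_real (exp (- (norm x)\<^sup>2 / 2)) * cis (x \<bullet> \<xi>)"
  unfolding modulated_gaussian_def exp_add cis_conv_exp
  by (simp add: power2_norm_eq_inner exp_of_real[symmetric])

text \<open>This is the characteristic function of the standard normal law, multiplied by its
  normalizing constant sqrt(2 pi).\<close>

lemma std_gaussian_fourier_real:
  fixes t :: real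
  shows "integrable lborel (\<lambda>x. complex_of_real (exp (- x\<^sup>2 / 2)) * cis (t * x))"
    and "(LINT x|lborel. complex_of_real (exp (- x\<^sup>2 / 2)) * cis (t * x)) =
          complex_of_real (sqrt (2 * pi) * exp (- t\<^sup>2 / 2))"
proof -
  have i: "integrable lborel (\<lambda>x::real. exp (- x\<^sup>2 / 2))"
  proof -
    have "integrable lborel (\<lambda>x. sqrt (2 * pi) * std_normal_density x)"
      by (intro integrable_mult_right) simp
    then show ?thesis by (simp add: std_normal_density_def)
  qed
  show "integrable lborel (\<lambda>x. complex_of_real (exp (- x\<^sup>2 / 2)) * cis (t * x))"
    by (intro integrable_mult_cis integrable_of_real i) auto
  have "complex_of_real (exp (- t\<^sup>2 / 2)) = char std_normal_distribution t"
    by (simp add: char_std_normal_distribution)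
  also have "\<dots> = (LINT x|lborel. std_normal_density x *\<^sub>R cis (t * x))"
    unfolding char_def cis_conv_exp by (subst integral_density) auto
  also have "\<dots> = (LINT x|lborel. complex_of_real (1 / sqrt (2 * pi)) * (complex_of_real (exp (- x\<^sup>2 / 2)) * cis (t * x)))"
    by (simp add: std_normal_density_def scaleR_conv_of_real mult.assoc)
  also have "\<dots> = complex_of_real (1 / sqrt (2 * pi)) * (LINT x|lborel. complex_of_real (exp (- x\<^sup>2 / 2)) * cis (t * x))"
    by (rule integral_mult_right_zero)
  finally show "(LINT x|lborel. complex_of_real (exp (- x\<^sup>2 / 2)) * cis (t * x)) =
          complex_of_real (sqrt (2 * pi) * exp (- t\<^sup>2 / 2))"
    by (simp add: field_simps)
qed

text \<open>The exponent is a sum over coordinates, so the integrand is a product and the integral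
  splits into one-dimensional Gaussian transforms at the coordinates of
  \<open>\<xi>\<close>.\<close>

lemma integral_modulated_gaussian:
  fixes \<xi> :: "'a::euclidean_space"
  shows "(LINT x|lborel. modulated_gaussian \<xi> x) =
    complex_of_real (sqrt (2 * pi) ^ DIM('a) * exp (- (norm \<xi>)\<^sup>2 / 2))"
proof -
  have norm2: "(norm v)\<^sup>2 = (\<Sum>b\<in>Basis. (v \<bullet> b)\<^sup>2)" for v :: 'a
    unfolding power2_norm_eq_inner by (subst euclidean_inner) (simp add: power2_eq_square)
  have "modulated_gaussian \<xi> x =
      (\<Prod>b\<in>Basis. complex_of_real (exp (- (x \<bullet> b)\<^sup>2 / 2)) * cis ((\<xi> \<bullet> b) * (x \<bullet> b)))" for x
  proof -
    have "- complex_of_real (x \<bullet> x) / 2 + \<i> * complex_of_real (x \<bullet> \<xi>) =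
        (\<Sum>b\<in>Basis. - complex_of_real ((x \<bullet> b)\<^sup>2) / 2 + \<i> * complex_of_real ((\<xi> \<bullet> b) * (x \<bullet> b)))"
      by (subst (1 2) euclidean_inner)
         (simp add: sum.distrib sum_subtractf sum_divide_distrib sum_negf sum_distrib_left power2_eq_square mult_ac)
    then have "modulated_gaussian \<xi> x =
       (\<Prod>b\<in>Basis. exp (- complex_of_real ((x \<bullet> b)\<^sup>2) / 2 + \<i> * complex_of_real ((\<xi> \<bullet> b) * (x \<bullet> b))))"
      unfolding modulated_gaussian_def by (simp only: exp_sum[OF finite_Basis])
    also have "\<dots> = (\<Prod>b\<in>Basis. complex_of_real (exp (- (x \<bullet> b)\<^sup>2 / 2)) * cis ((\<xi> \<bullet> b) * (x \<bullet> b)))"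
      unfolding exp_add cis_conv_exp by (simp add: exp_of_real[symmetric])
    finally show ?thesis .
  qed
  then have "(LINT x|lborel. modulated_gaussian \<xi> x) =
     (\<Prod>b\<in>Basis. LINT t|lborel. complex_of_real (exp (- t\<^sup>2 / 2)) * cis ((\<xi> \<bullet> b) * t))"
    by (simp only: lborel_prod_Basis(2)[of "\<lambda>b t. complex_of_real (exp (- t\<^sup>2 / 2)) * cis ((\<xi> \<bullet> b) * t)",
          OF std_gaussian_fourier_real(1)])
  also have "\<dots> = (\<Prod>b\<in>Basis. complex_of_real (sqrt (2 * pi)) * complex_of_real (exp (- (\<xi> \<bullet> b)\<^sup>2 / 2)))"
    by (simp only: std_gaussian_fourier_real(2) of_real_mult)
  also have "\<dots> = complex_of_real (sqrt (2 * pi)) ^ DIM('a) * complex_of_real (exp (\<Sum>b\<in>Basis. - (\<xi> \<bullet> b)\<^sup>2 / 2))"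
    by (simp only: prod.distrib prod_constant of_real_prod exp_sum[OF finite_Basis])
  also have "(\<Sum>b\<in>Basis. - (\<xi> \<bullet> b)\<^sup>2 / 2) = - (norm \<xi>)\<^sup>2 / 2"
    by (simp add: norm2 sum_negf sum_divide_distrib)
  finally show ?thesis by simp
qed

lemma integrable_gaussian:
  "integrable lborel (\<lambda>x::'a::euclidean_space. exp (- (norm x)\<^sup>2 / 2))"
  using integrable_norm[OF schwartz_integrable[OF modulated_gaussian_schwartz, of "0::'a"]]
  by (simp add: norm_modulated_gaussian)

lemma integral_gaussian:
  "(LINT x::'a::euclidean_space|lborel. exp (- (norm x)\<^sup>2 / 2)) = sqrt (2 * pi) ^ DIM('a)"
proof -
  have "complex_of_real (LINT x::'a|lborel. exp (- (norm x)\<^sup>2 / 2)) = (LINT x::'a|lborel. modulated_gaussian 0 x)"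
    unfolding integral_complex_of_real[symmetric]
    by (rule Bochner_Integration.integral_cong) (auto simp: modulated_gaussian_cis)
  also have "\<dots> = complex_of_real (sqrt (2 * pi) ^ DIM('a))"
    by (subst integral_modulated_gaussian) simp
  finally show ?thesis by (simp only: of_real_eq_iff)
qed

section \<open>Gaussian means, Fourier inversion and uniqueness for integrable functions\<close>

lemma integrable_pair_mult:
  fixes f :: "'a::euclidean_space \<Rightarrow> complex" and g :: "'b::euclidean_space \<Rightarrow> complex"
  assumes f: "integrable lborel f" and g: "integrable lborel g"
  shows "integrable (lborel \<Otimes>\<^sub>M lborel) (\<lambda>(x, y). f x * g y)"
proof (rule lborel_pair.Fubini_integrable)
  have [measurable]: "f \<in> borel_measurable borel" "g \<in> borel_measurable borel" using f g by auto
  show "(\<lambda>(x, y). f x * g y) \<in> borel_measurable (lborel \<Otimes>\<^sub>M lborel)" by measurable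
  show "integrable lborel (\<lambda>x. LINT y|lborel. norm (case (x, y) of (x, y) \<Rightarrow> f x * g y))"
    using f by (simp add: norm_mult)
  show "AE x in lborel. integrable lborel (\<lambda>y. case (x, y) of (x, y) \<Rightarrow> f x * g y)"
    using g by simp
qed

text \<open>Multiplication formula against a Gaussian of width \<open>1 / \<epsilon>\<close>; letting \<open>\<epsilon> \<rightarrow> 0\<close>
  yields both Fourier inversion and uniqueness.\<close>

lemma fourier_gaussian_mean:
  fixes f :: "'a::euclidean_space \<Rightarrow> complex"
  assumes f: "integrable lborel f" and e: "\<epsilon> > 0"
  shows "(LINT z|lborel. fourier f z * (complex_of_real (exp (- (norm (\<epsilon> *\<^sub>R z))\<^sup>2 / 2)) * cis (s \<bullet> z))) =
    complex_of_real (sqrt (2 * pi) ^ DIM('a)) *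
      (LINT u|lborel. f (s + \<epsilon> *\<^sub>R u) * complex_of_real (exp (- (norm u)\<^sup>2 / 2)))"
proof -
  have fm [measurable]: "f \<in> borel_measurable borel" using f by auto
  define g :: "'a \<Rightarrow> real" where "g = (\<lambda>x. exp (- (norm x)\<^sup>2 / 2))"
  have [measurable]: "g \<in> borel_measurable borel" unfolding g_def by measurable
  have gi: "integrable lborel (\<lambda>z. complex_of_real (g (\<epsilon> *\<^sub>R z)))"
    using lborel_integrable_affine[of \<epsilon> "\<lambda>x. complex_of_real (g x)" 0] e integrable_of_real[OF integrable_gaussian]
    unfolding g_def by simp
  have int: "integrable (lborel \<Otimes>\<^sub>M lborel)
      (\<lambda>(x, z). f x * complex_of_real (g (\<epsilon> *\<^sub>R z)) * cis (z \<bullet> (s - x)))"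
    using integrable_mult_cis[OF integrable_pair_mult[OF f gi], of "\<lambda>(x, z). z \<bullet> (s - x)"]
    by (simp add: case_prod_beta')
  have inner: "(LINT z|lborel. complex_of_real (g (\<epsilon> *\<^sub>R z)) * cis (z \<bullet> (s - x))) =
     complex_of_real (inverse \<epsilon> ^ DIM('a) * (sqrt (2 * pi) ^ DIM('a) * g ((x - s) /\<^sub>R \<epsilon>)))" for x
  proof -
    have "(LINT z|lborel. complex_of_real (g (\<epsilon> *\<^sub>R z)) * cis (z \<bullet> (s - x))) =
       \<bar>inverse \<epsilon>\<bar> ^ DIM('a) *\<^sub>R (LINT y|lborel. complex_of_real (g (\<epsilon> *\<^sub>R (0 + inverse \<epsilon> *\<^sub>R y))) *
           cis ((0 + inverse \<epsilon> *\<^sub>R y) \<bullet> (s - x)))"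
      using e by (intro lborel_integral_affine) auto
    also have "\<dots> = inverse \<epsilon> ^ DIM('a) *\<^sub>R (LINT y|lborel. modulated_gaussian ((s - x) /\<^sub>R \<epsilon>) y)"
      using e by (simp add: modulated_gaussian_cis g_def)
    also have "(LINT y|lborel. modulated_gaussian ((s - x) /\<^sub>R \<epsilon>) y) =
        complex_of_real (sqrt (2 * pi) ^ DIM('a) * g ((x - s) /\<^sub>R \<epsilon>))"
      by (subst integral_modulated_gaussian) (simp add: g_def norm_minus_commute)
    finally show ?thesis by (simp add: scaleR_conv_of_real)
  qed
  have "(LINT z|lborel. fourier f z * (complex_of_real (g (\<epsilon> *\<^sub>R z)) * cis (s \<bullet> z))) =
      (LINT z|lborel. LINT x|lborel. f x * complex_of_real (g (\<epsilon> *\<^sub>R z)) * cis (z \<bullet> (s - x)))"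
  proof (rule Bochner_Integration.integral_cong[OF refl])
    fix z
    have "f x * complex_of_real (g (\<epsilon> *\<^sub>R z)) * cis (z \<bullet> (s - x)) =
        (f x * cis (- (z \<bullet> x))) * (complex_of_real (g (\<epsilon> *\<^sub>R z)) * cis (s \<bullet> z))" for x
    proof -
      have "cis (z \<bullet> (s - x)) = cis (- (z \<bullet> x)) * cis (s \<bullet> z)"
        by (simp add: cis_mult inner_diff_right inner_commute)
      then show ?thesis by simp
    qed
    then show "fourier f z * (complex_of_real (g (\<epsilon> *\<^sub>R z)) * cis (s \<bullet> z)) =
        (LINT x|lborel. f x * complex_of_real (g (\<epsilon> *\<^sub>R z)) * cis (z \<bullet> (s - x)))"
      unfolding fourier_cis by (simp only: integral_mult_left_zero)
  qed
  also have "\<dots> = (LINT x|lborel. LINT z|lborel. f x * complex_of_real (g (\<epsilon> *\<^sub>R z)) * cis (z \<bullet> (s - x)))"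
    by (rule lborel_pair.Fubini_integral[OF int])
  also have "\<dots> = (LINT x|lborel. f x * complex_of_real (inverse \<epsilon> ^ DIM('a) * (sqrt (2 * pi) ^ DIM('a) * g ((x - s) /\<^sub>R \<epsilon>))))"
    by (simp only: mult.assoc integral_mult_right_zero inner)
  \<comment> \<open>Substituting x = s + eps u produces a Jacobian eps^d, which cancels the eps^-d
    left by the inner integral.\<close>
  also have "\<dots> = \<bar>\<epsilon>\<bar> ^ DIM('a) *\<^sub>R (LINT u|lborel. f (s + \<epsilon> *\<^sub>R u) *
       complex_of_real (inverse \<epsilon> ^ DIM('a) * (sqrt (2 * pi) ^ DIM('a) * g (((s + \<epsilon> *\<^sub>R u) - s) /\<^sub>R \<epsilon>))))"
    using e by (intro lborel_integral_affine) auto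
  also have "\<dots> = \<bar>\<epsilon>\<bar> ^ DIM('a) *\<^sub>R (LINT u|lborel. complex_of_real (inverse \<epsilon> ^ DIM('a)) *
      (complex_of_real (sqrt (2 * pi) ^ DIM('a)) * (f (s + \<epsilon> *\<^sub>R u) * complex_of_real (g u))))"
    using e by (intro arg_cong2[where f=scaleR] refl Bochner_Integration.integral_cong) (auto simp: mult_ac)
  also have "\<dots> = complex_of_real (sqrt (2 * pi) ^ DIM('a)) * (LINT u|lborel. f (s + \<epsilon> *\<^sub>R u) * complex_of_real (g u))"
    unfolding integral_mult_right_zero using e by (simp add: scaleR_conv_of_real field_simps)
  finally show ?thesis unfolding g_def .
qed

lemma gaussian_dilation_tendsto:
  "(\<lambda>n. exp (- (norm (inverse (real (Suc n)) *\<^sub>R z))\<^sup>2 / 2)) \<longlonglongrightarrow> 1" for z :: "'a::euclidean_space"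
proof -
  have "(\<lambda>n. exp (- (norm (inverse (real (Suc n)) *\<^sub>R z))\<^sup>2 / 2)) \<longlonglongrightarrow> exp (- (norm (0 *\<^sub>R z))\<^sup>2 / 2)"
    by (intro tendsto_intros LIMSEQ_inverse_real_of_nat) auto
  then show ?thesis by simp
qed

text \<open>Both sides of the Gaussian mean formula converge by dominated convergence along eps =
  1/(n+1): the left one under |fourier f|, the right one under B times the Gaussian, with continuity
  giving the pointwise limit. The constant (2 pi)^d is a product of two factors sqrt(2 pi)^d, one
  from the transform of the Gaussian and one from its integral.\<close>

theorem fourier_inversion:
  fixes f :: "'a::euclidean_space \<Rightarrow> complex"
  assumes f: "integrable lborel f" and ff: "integrable lborel (fourier f)"
    and cont: "continuous_on UNIV f" and bnd: "\<And>x. norm (f x) \<le> B"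
  shows "(LINT z|lborel. fourier f z * cis (s \<bullet> z)) = complex_of_real ((2 * pi) ^ DIM('a)) * f s"
proof -
  let ?e = "\<lambda>n. inverse (real (Suc n))"
  let ?c = "complex_of_real (sqrt (2 * pi) ^ DIM('a))"
  have fm [measurable]: "f \<in> borel_measurable borel" using f by auto
  have ffm [measurable]: "fourier f \<in> borel_measurable borel" using ff by auto
  have L: "(\<lambda>n. LINT z|lborel. fourier f z * (complex_of_real (exp (- (norm (?e n *\<^sub>R z))\<^sup>2 / 2)) * cis (s \<bullet> z)))
      \<longlonglongrightarrow> (LINT z|lborel. fourier f z * cis (s \<bullet> z))"
  proof (rule integral_dominated_convergence)
    show "integrable lborel (\<lambda>z. norm (fourier f z))" using ff by simp
    show "AE z in lborel. (\<lambda>n. fourier f z * (complex_of_real (exp (- (norm (?e n *\<^sub>R z))\<^sup>2 / 2)) * cis (s \<bullet> z)))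
        \<longlonglongrightarrow> fourier f z * cis (s \<bullet> z)"
    proof (rule AE_I2)
      fix z :: 'a
      have "(\<lambda>n. fourier f z * (complex_of_real (exp (- (norm (?e n *\<^sub>R z))\<^sup>2 / 2)) * cis (s \<bullet> z)))
        \<longlonglongrightarrow> fourier f z * (complex_of_real 1 * cis (s \<bullet> z))"
        by (intro tendsto_mult tendsto_const tendsto_of_real gaussian_dilation_tendsto)
      then show "(\<lambda>n. fourier f z * (complex_of_real (exp (- (norm (?e n *\<^sub>R z))\<^sup>2 / 2)) * cis (s \<bullet> z)))
        \<longlonglongrightarrow> fourier f z * cis (s \<bullet> z)" by simp
    qed
    show "AE z in lborel. norm (fourier f z * (complex_of_real (exp (- (norm (?e n *\<^sub>R z))\<^sup>2 / 2)) * cis (s \<bullet> z)))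
        \<le> norm (fourier f z)" for n
      by (auto simp: norm_mult intro!: mult_right_le_one_le)
  qed measurable
  have R: "(\<lambda>n. LINT u|lborel. f (s + ?e n *\<^sub>R u) * complex_of_real (exp (- (norm u)\<^sup>2 / 2)))
     \<longlonglongrightarrow> (LINT u|lborel. f s * complex_of_real (exp (- (norm (u::'a))\<^sup>2 / 2)))"
  proof (rule integral_dominated_convergence)
    show "integrable lborel (\<lambda>u::'a. B * exp (- (norm u)\<^sup>2 / 2))"
      by (intro integrable_mult_right integrable_gaussian)
    show "AE u in lborel. (\<lambda>n. f (s + ?e n *\<^sub>R u) * complex_of_real (exp (- (norm u)\<^sup>2 / 2)))
       \<longlonglongrightarrow> f s * complex_of_real (exp (- (norm u)\<^sup>2 / 2))"
    proof (rule AE_I2)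
      fix u
      have "(\<lambda>n. s + ?e n *\<^sub>R u) \<longlonglongrightarrow> s + 0 *\<^sub>R u"
        by (intro tendsto_intros LIMSEQ_inverse_real_of_nat)
      then have "(\<lambda>n. f (s + ?e n *\<^sub>R u)) \<longlonglongrightarrow> f s"
        using continuous_on_tendsto_compose[OF cont] by simp
      then show "(\<lambda>n. f (s + ?e n *\<^sub>R u) * complex_of_real (exp (- (norm u)\<^sup>2 / 2)))
       \<longlonglongrightarrow> f s * complex_of_real (exp (- (norm u)\<^sup>2 / 2))"
        by (intro tendsto_mult tendsto_const)
    qed
    show "AE u in lborel. norm (f (s + ?e n *\<^sub>R u) * complex_of_real (exp (- (norm u)\<^sup>2 / 2)))
        \<le> B * exp (- (norm u)\<^sup>2 / 2)" for n
      by (auto simp: norm_mult intro!: bnd)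
  qed measurable
  have "?e n > 0" for n by simp
  note L = L[unfolded fourier_gaussian_mean[OF f this]]
  have "(LINT z|lborel. fourier f z * cis (s \<bullet> z)) =
      ?c * (LINT u|lborel. f s * complex_of_real (exp (- (norm (u::'a))\<^sup>2 / 2)))"
    by (rule LIMSEQ_unique[OF L tendsto_mult[OF tendsto_const R]])
  also have "\<dots> = ?c * (f s * complex_of_real (LINT u::'a|lborel. exp (- (norm u)\<^sup>2 / 2)))"
    by (simp only: integral_mult_right_zero integral_complex_of_real)
  also have "\<dots> = complex_of_real ((2 * pi) ^ DIM('a)) * f s"
  proof -
    have "sqrt (2 * pi) ^ DIM('a) * sqrt (2 * pi) ^ DIM('a) = (2 * pi) ^ DIM('a)"
      unfolding power_mult_distrib[symmetric] by simp
    then have "?c * ?c = complex_of_real ((2 * pi) ^ DIM('a))"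
      unfolding of_real_mult[symmetric] by simp
    then show ?thesis
      unfolding integral_gaussian by (simp only: mult.left_commute[of ?c] mult.commute[of _ "f s"])
  qed
  finally show ?thesis .
qed

text \<open>Here f is merely integrable, so its Gaussian means need not converge pointwise. They are
  tested against a bounded continuous function instead, and the conclusion passes from such
  functions to closed sets and then to all Borel sets.\<close>

theorem fourier_eq_0_imp_AE_eq_0:
  fixes f :: "'a::euclidean_space \<Rightarrow> complex"
  assumes f: "integrable lborel f" and zero: "AE z in lborel. fourier f z = 0"
  shows "AE x in lborel. f x = 0"
proof -
  let ?e = "\<lambda>n. inverse (real (Suc n))"
  have fm [measurable]: "f \<in> borel_measurable borel" using f by auto
  have fae: "integrable lborel (\<lambda>x. f (t + c *\<^sub>R x))" if "c \<noteq> 0" for t c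
    by (rule lborel_integrable_affine[OF that f])
  define g :: "'a \<Rightarrow> real" where "g = (\<lambda>x. exp (- (norm x)\<^sup>2 / 2))"
  have [measurable]: "g \<in> borel_measurable borel" unfolding g_def by measurable
  have gi: "integrable lborel g" unfolding g_def by (rule integrable_gaussian)
  have gpos: "g u > 0" for u unfolding g_def by simp
  have conv0: "(LINT u|lborel. f (s + \<epsilon> *\<^sub>R u) * complex_of_real (g u)) = 0" if "\<epsilon> > 0" for s \<epsilon>
  proof -
    have "(LINT z|lborel. fourier f z * (complex_of_real (exp (- (norm (\<epsilon> *\<^sub>R z))\<^sup>2 / 2)) * cis (s \<bullet> z))) = 0"
      by (rule integral_eq_zero_AE) (use zero in auto)
    then show ?thesis
      unfolding fourier_gaussian_mean[OF f that] g_def by simp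
  qed
  have test: "(LINT x|lborel. complex_of_real (\<psi> x) * f x) = 0"
    if cont: "continuous_on UNIV \<psi>" and bnd: "\<And>x. \<bar>\<psi> x\<bar> \<le> 1" for \<psi> :: "'a \<Rightarrow> real"
  proof -
    have [measurable]: "\<psi> \<in> borel_measurable borel"
      by (intro borel_measurable_continuous_onI cont)
    \<comment> \<open>Fubini and translation invariance move the shift from f to the continuous
      \<open>\<psi>\<close>, where the limit eps -> 0 can be taken pointwise; the integral with the
      shift still on f vanishes by \<open>conv0\<close>.\<close>
    have step: "(LINT u|lborel. complex_of_real (g u) * (LINT x|lborel. complex_of_real (\<psi> (x - \<epsilon> *\<^sub>R u)) * f x)) = 0"
      if e: "\<epsilon> > 0" for \<epsilon>
    proof -
      have "integrable (lborel \<Otimes>\<^sub>M lborel) (\<lambda>(u, s). complex_of_real (g u) * f (s + \<epsilon> *\<^sub>R u))"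
      proof (rule lborel_pair.Fubini_integrable)
        have "(LINT s|lborel. norm (f (s + \<epsilon> *\<^sub>R u))) = (LINT s|lborel. norm (f s))" for u
          using lborel_integral_translate[of "\<lambda>s. norm (f s)" "\<epsilon> *\<^sub>R u"] by (simp add: add.commute)
        then show "integrable lborel (\<lambda>u. LINT s|lborel. norm (case (u, s) of (u, s) \<Rightarrow> complex_of_real (g u) * f (s + \<epsilon> *\<^sub>R u)))"
          using gi by (simp add: norm_mult)
        show "AE u in lborel. integrable lborel (\<lambda>s. case (u, s) of (u, s) \<Rightarrow> complex_of_real (g u) * f (s + \<epsilon> *\<^sub>R u))"
          using fae[of 1] by (auto simp: add.commute[of _ "\<epsilon> *\<^sub>R _"] intro!: AE_I2 integrable_mult_right)
      qed measurable
      then have int: "integrable (lborel \<Otimes>\<^sub>M lborel)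
          (\<lambda>(u, s). complex_of_real (\<psi> s) * (complex_of_real (g u) * f (s + \<epsilon> *\<^sub>R u)))"
        by (rule Bochner_Integration.integrable_bound) (auto simp: norm_mult case_prod_beta' intro!: mult_left_le_one_le bnd)
      have "(LINT u|lborel. complex_of_real (g u) * (LINT x|lborel. complex_of_real (\<psi> (x - \<epsilon> *\<^sub>R u)) * f x)) =
          (LINT u|lborel. LINT s|lborel. complex_of_real (\<psi> s) * (complex_of_real (g u) * f (s + \<epsilon> *\<^sub>R u)))"
      proof (rule Bochner_Integration.integral_cong[OF refl])
        fix u
        have "(LINT x|lborel. complex_of_real (\<psi> (x - \<epsilon> *\<^sub>R u)) * f x) =
            (LINT s|lborel. complex_of_real (\<psi> (\<epsilon> *\<^sub>R u + s - \<epsilon> *\<^sub>R u)) * f (\<epsilon> *\<^sub>R u + s))"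
          by (rule lborel_integral_translate[symmetric]) measurable
        also have "\<dots> = (LINT s|lborel. complex_of_real (\<psi> s) * f (s + \<epsilon> *\<^sub>R u))"
          by (simp add: add.commute)
        finally show "complex_of_real (g u) * (LINT x|lborel. complex_of_real (\<psi> (x - \<epsilon> *\<^sub>R u)) * f x) =
          (LINT s|lborel. complex_of_real (\<psi> s) * (complex_of_real (g u) * f (s + \<epsilon> *\<^sub>R u)))"
          by (simp only: mult.left_commute[of _ "complex_of_real (g u)"] integral_mult_right_zero)
      qed
      also have "\<dots> = (LINT s|lborel. LINT u|lborel. complex_of_real (\<psi> s) * (complex_of_real (g u) * f (s + \<epsilon> *\<^sub>R u)))"
        by (rule lborel_pair.Fubini_integral[OF int, symmetric])
      also have "\<dots> = 0"
        using conv0[OF e] by (simp add: mult.commute[of "complex_of_real (g _)"])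
      finally show ?thesis .
    qed
    let ?I = "LINT x|lborel. complex_of_real (\<psi> x) * f x"
    let ?J = "LINT x|lborel. norm (f x)"
    have inner_lim: "(\<lambda>n. LINT x|lborel. complex_of_real (\<psi> (x - ?e n *\<^sub>R u)) * f x) \<longlonglongrightarrow> ?I" for u
    proof (rule integral_dominated_convergence)
      show "integrable lborel (\<lambda>x. norm (f x))" using f by simp
      show "AE x in lborel. (\<lambda>n. complex_of_real (\<psi> (x - ?e n *\<^sub>R u)) * f x) \<longlonglongrightarrow> complex_of_real (\<psi> x) * f x"
      proof (rule AE_I2)
        fix x
        have "(\<lambda>n. x - ?e n *\<^sub>R u) \<longlonglongrightarrow> x - 0 *\<^sub>R u"
          by (intro tendsto_intros LIMSEQ_inverse_real_of_nat)
        then have "(\<lambda>n. \<psi> (x - ?e n *\<^sub>R u)) \<longlonglongrightarrow> \<psi> x"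
          using continuous_on_tendsto_compose[OF cont] by simp
        then show "(\<lambda>n. complex_of_real (\<psi> (x - ?e n *\<^sub>R u)) * f x) \<longlonglongrightarrow> complex_of_real (\<psi> x) * f x"
          by (intro tendsto_intros)
      qed
      show "AE x in lborel. norm (complex_of_real (\<psi> (x - ?e n *\<^sub>R u)) * f x) \<le> norm (f x)" for n
        by (auto simp: norm_mult intro!: mult_left_le_one_le bnd)
    qed measurable
    have "(\<lambda>n. LINT u|lborel. complex_of_real (g u) * (LINT x|lborel. complex_of_real (\<psi> (x - ?e n *\<^sub>R u)) * f x))
        \<longlonglongrightarrow> (LINT u|lborel. complex_of_real (g u) * ?I)"
    proof (rule integral_dominated_convergence)
      show "integrable lborel (\<lambda>u. g u * ?J)" using gi by simp
      show "AE u in lborel. (\<lambda>n. complex_of_real (g u) * (LINT x|lborel. complex_of_real (\<psi> (x - ?e n *\<^sub>R u)) * f x))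
         \<longlonglongrightarrow> complex_of_real (g u) * ?I"
        by (intro AE_I2 tendsto_mult tendsto_const inner_lim)
      show "AE u in lborel. norm (complex_of_real (g u) * (LINT x|lborel. complex_of_real (\<psi> (x - ?e n *\<^sub>R u)) * f x))
         \<le> g u * ?J" for n
      proof (rule AE_I2)
        fix u
        have "norm (LINT x|lborel. complex_of_real (\<psi> (x - ?e n *\<^sub>R u)) * f x) \<le> ?J"
          by (intro order_trans[OF integral_norm_bound] integral_mono integrable_norm
                Bochner_Integration.integrable_bound[OF f] f)
             (auto simp: norm_mult intro!: mult_left_le_one_le bnd)
        then show "norm (complex_of_real (g u) * (LINT x|lborel. complex_of_real (\<psi> (x - ?e n *\<^sub>R u)) * f x))
         \<le> g u * ?J"
          using gpos[of u] by (simp add: norm_mult)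
      qed
    qed measurable
    then have "(LINT u|lborel. complex_of_real (g u) * ?I) = 0"
      by (simp add: step LIMSEQ_const_iff)
    \<comment> \<open>The limit says that the total Gaussian mass times the wanted integral is zero,
      so the mass must be nonzero.\<close>
    moreover have "integral\<^sup>L lborel g \<noteq> 0"
      unfolding g_def integral_gaussian by simp
    ultimately show ?thesis by simp
  qed
  have closed0: "(LINT x|lborel. indicator A x *\<^sub>R f x) = 0" if A: "closed A" for A
  proof (cases "A = {}")
    case False
    have [measurable]: "A \<in> sets borel" using A by simp
    have [measurable]: "(\<lambda>x. infdist x A) \<in> borel_measurable borel"
      by (intro borel_measurable_continuous_onI continuous_intros)
    \<comment> \<open>These continuous ramps equal 1 on A and tend to 0 off A, since a point outside
      a closed set has positive distance from it.\<close>
    have "(\<lambda>n. LINT x|lborel. complex_of_real (max 0 (1 - real n * infdist x A)) * f x)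
        \<longlonglongrightarrow> (LINT x|lborel. indicator A x *\<^sub>R f x)"
    proof (rule integral_dominated_convergence)
      show "integrable lborel (\<lambda>x. norm (f x))" using f by simp
      show "AE x in lborel. (\<lambda>n. complex_of_real (max 0 (1 - real n * infdist x A)) * f x) \<longlonglongrightarrow> indicator A x *\<^sub>R f x"
      proof (rule AE_I2)
        fix x
        have "(\<lambda>n. max 0 (1 - real n * infdist x A)) \<longlonglongrightarrow> indicator A x"
        proof (cases "x \<in> A")
          case True
          then show ?thesis by simp
        next
          case False
          with A \<open>A \<noteq> {}\<close> have pos: "infdist x A > 0"
            by (meson infdist_pos_not_in_closed)
          obtain N where N: "1 < real N * infdist x A"
            using reals_Archimedean3[OF pos] by blast
          have "max 0 (1 - real n * infdist x A) = 0" if "n \<ge> N" for n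
          proof -
            have "real N * infdist x A \<le> real n * infdist x A"
              using that pos by (intro mult_right_mono) auto
            then show ?thesis using N by linarith
          qed
          then have "\<forall>\<^sub>F n in sequentially. max 0 (1 - real n * infdist x A) = 0"
            using eventually_sequentially by blast
          then show ?thesis using False by (simp add: tendsto_eventually)
        qed
        then show "(\<lambda>n. complex_of_real (max 0 (1 - real n * infdist x A)) * f x) \<longlonglongrightarrow> indicator A x *\<^sub>R f x"
          unfolding scaleR_conv_of_real by (intro tendsto_mult tendsto_const tendsto_of_real)
      qed
      show "AE x in lborel. norm (complex_of_real (max 0 (1 - real n * infdist x A)) * f x) \<le> norm (f x)" for n
        by (auto simp: norm_mult infdist_nonneg intro!: mult_left_le_one_le)
    qed measurable
    moreover have "(LINT x|lborel. complex_of_real (max 0 (1 - real n * infdist x A)) * f x) = 0" for n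
      by (rule test) (auto intro!: continuous_intros simp: infdist_nonneg)
    ultimately show ?thesis by (simp add: LIMSEQ_const_iff)
  qed simp
  have setint: "set_integrable lborel A f" if "A \<in> sets borel" for A
    using that f unfolding set_integrable_def by (intro integrable_mult_indicator) auto
  have all0: "set_lebesgue_integral lborel A f = 0" if "A \<in> sets borel" for A
  proof -
    have sb: "sigma_sets UNIV (Collect closed) = sets (borel :: 'a measure)"
      by (simp add: borel_eq_closed sets_measure_of)
    \<comment> \<open>Closed sets form an intersection-stable generator of the Borel sets, so it is
      enough that sets with vanishing integral are closed under complements and disjoint countable
      unions.\<close>
    have "Int_stable (Collect closed :: 'a set set)" by (auto simp: Int_stable_def)
    moreover have "Collect closed \<subseteq> Pow (UNIV :: 'a set)" by simp
    moreover have "A \<in> sigma_sets UNIV (Collect closed)" using that sb by simp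
    ultimately show ?thesis
    proof (induction rule: sigma_sets_induct_disjoint)
      case (basic A)
      then show ?case using closed0 by (simp add: set_lebesgue_integral_def)
    next
      case empty
      then show ?case by (simp add: set_lebesgue_integral_def)
    next
      case (compl A)
      have "set_lebesgue_integral lborel (UNIV - A) f = set_lebesgue_integral lborel UNIV f - set_lebesgue_integral lborel A f"
      proof -
        have "set_lebesgue_integral lborel (A \<union> (UNIV - A)) f = set_lebesgue_integral lborel A f + set_lebesgue_integral lborel (UNIV - A) f"
          by (rule set_integral_Un) (use compl sb setint in auto)
        then show ?thesis by simp
      qed
      \<comment> \<open>The whole space is itself closed, which starts the complement step.\<close>
      also have "set_lebesgue_integral lborel UNIV f = 0"
        using closed0[of UNIV] by (simp add: set_lebesgue_integral_def)
      finally show ?case using compl by simp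
    next
      case (union A)
      have "set_lebesgue_integral lborel (\<Union>i. A i) f = (\<Sum>i. set_lebesgue_integral lborel (A i) f)"
      proof (rule lebesgue_integral_countable_add)
        show "A i \<in> sets lborel" for i using union sb by auto
        show "set_integrable lborel (\<Union>i. A i) f" using union sb by (intro setint sets.countable_UN) auto
      qed (use union in \<open>auto simp: disjoint_family_on_def\<close>)
      then show ?case using union by simp
    qed
  qed
  show ?thesis
    by (rule sigma_finite_measure.density_zero[OF lborel.sigma_finite_measure_axioms f]) (use all0 in auto)
qed


section \<open>The Fourier transform on the Schwartz space\<close>

lemma has_derivative_cis:
  assumes "(g has_derivative g') (at x)"
  shows "((\<lambda>x. cis (g x)) has_derivative (\<lambda>v. \<i> * complex_of_real (g' v) * cis (g x))) (at x)"
proof -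
  have "((\<lambda>x. \<i> * complex_of_real (g x)) has_derivative (\<lambda>v. \<i> * complex_of_real (g' v))) (at x)"
    using assms by (auto intro!: derivative_eq_intros)
  from has_derivative_compose[OF this DERIV_exp[unfolded has_field_derivative_def]]
  show ?thesis unfolding cis_conv_exp by (simp add: mult.commute)
qed

text \<open>The case m = 2 supplies the constant of the quadratic remainder estimate for the
  derivative of the transform.\<close>

lemma integrable_norm_power_mult_schwartz:
  assumes f: "f \<in> schwartz"
  shows "integrable lborel (\<lambda>x. norm x ^ m * norm (f x))"
proof -
  have [measurable]: "f \<in> borel_measurable borel" by (rule schwartz_measurable[OF f])
  have "rapidly_decreasing (\<lambda>x. complex_of_real (norm x ^ m) * f x)"
    unfolding rapidly_decreasing_def
  proof
    fix n
    obtain C where "\<And>x. norm x ^ (n + m) * norm (f x) \<le> C"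
      using rapidly_decreasingE[OF schwartz_rapidly_decreasing[OF f]] by blast
    then show "\<exists>C. \<forall>x. norm x ^ n * norm (complex_of_real (norm x ^ m) * f x) \<le> C"
      by (auto simp: norm_mult norm_power power_add mult.assoc)
  qed
  then have "integrable lborel (\<lambda>x. norm (complex_of_real (norm x ^ m) * f x))"
    by (intro integrable_norm rapidly_decreasing_integrable) auto
  then show ?thesis by (simp add: norm_mult norm_power)
qed

text \<open>The first-order remainder is estimated directly: the second-order Taylor bound for the
  exponential gives |h|^2 times the second absolute moment of f, uniformly in z.\<close>

lemma fourier_has_derivative:
  fixes f :: "'a::euclidean_space \<Rightarrow> complex"
  assumes f: "f \<in> schwartz"
  shows "(fourier f has_derivative (\<lambda>v. fourier (\<lambda>s. - \<i> * (complex_of_real (s \<bullet> v) * f s)) z)) (at z)"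
  unfolding has_derivative_at
proof
  let ?D = "\<lambda>v. fourier (\<lambda>s. - \<i> * (complex_of_real (s \<bullet> v) * f s)) z"
  have [measurable]: "f \<in> borel_measurable borel" by (rule schwartz_measurable[OF f])
  have fi: "integrable lborel f" by (rule schwartz_integrable[OF f])
  have Di: "integrable lborel (\<lambda>s. - \<i> * (complex_of_real (s \<bullet> v) * f s) * cis (- (z \<bullet> s)))" for v
    by (intro integrable_mult_cis schwartz_integrable schwartz_cmult schwartz_inner_mult f) auto
  have "linear ?D"
  proof
    fix u v
    have "?D (u + v) = (LINT s|lborel. - \<i> * (complex_of_real (s \<bullet> u) * f s) * cis (- (z \<bullet> s))
        + - \<i> * (complex_of_real (s \<bullet> v) * f s) * cis (- (z \<bullet> s)))"
      unfolding fourier_cis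
      by (intro Bochner_Integration.integral_cong refl) (simp add: inner_add_right algebra_simps)
    also have "\<dots> = ?D u + ?D v"
      unfolding fourier_cis by (intro Bochner_Integration.integral_add Di)
    finally show "?D (u + v) = ?D u + ?D v" .
  next
    fix r :: real and v
    have "?D (r *\<^sub>R v) = (LINT s|lborel. complex_of_real r * (- \<i> * (complex_of_real (s \<bullet> v) * f s) * cis (- (z \<bullet> s))))"
      unfolding fourier_cis
      by (intro Bochner_Integration.integral_cong refl) (simp add: algebra_simps)
    also have "\<dots> = r *\<^sub>R ?D v"
      unfolding fourier_cis integral_mult_right_zero by (simp add: scaleR_conv_of_real)
    finally show "?D (r *\<^sub>R v) = r *\<^sub>R ?D v" .
  qed
  then show "bounded_linear ?D" by (simp add: linear_conv_bounded_linear)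
  define C where "C = (LINT s|lborel. norm s ^ 2 * norm (f s))"
  have bnd: "norm (fourier f (z + h) - fourier f z - ?D h) \<le> (norm h)\<^sup>2 * C" for h
  proof -
    let ?R = "\<lambda>s. f s * cis (- ((z + h) \<bullet> s)) - f s * cis (- (z \<bullet> s)) -
        - \<i> * (complex_of_real (s \<bullet> h) * f s) * cis (- (z \<bullet> s))"
    have fc: "integrable lborel (\<lambda>s. f s * cis (- (w \<bullet> s)))" for w
      by (intro integrable_mult_cis fi) auto
    have eq: "fourier f (z + h) - fourier f z - ?D h = (LINT s|lborel. ?R s)"
      unfolding fourier_cis
      by (simp only: Bochner_Integration.integral_diff[OF Bochner_Integration.integrable_diff[OF fc fc] Di]
          Bochner_Integration.integral_diff[OF fc fc])
    have "norm (fourier f (z + h) - fourier f z - ?D h) \<le> (LINT s|lborel. norm (?R s))"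
      unfolding eq by (rule integral_norm_bound)
    also have "\<dots> \<le> (LINT s|lborel. (norm h)\<^sup>2 * (norm s ^ 2 * norm (f s)))"
    proof (rule integral_mono)
      show "integrable lborel (\<lambda>s. norm (?R s))"
        by (intro integrable_norm Bochner_Integration.integrable_diff fc Di)
      show "integrable lborel (\<lambda>s. (norm h)\<^sup>2 * (norm s ^ 2 * norm (f s)))"
        by (intro integrable_mult_right integrable_norm_power_mult_schwartz f)
      fix s
      let ?x = "- (h \<bullet> s)"
      \<comment> \<open>With the plane wave at z factored out, what remains is the exponential minus
        its first two Taylor terms at -(h . s).\<close>
      have "?R s = f s * cis (- (z \<bullet> s)) * (iexp ?x - (\<Sum>k\<le>1. (\<i> * ?x) ^ k / fact k))"
      proof -
        have "cis (- ((z + h) \<bullet> s)) = cis (- (z \<bullet> s)) * cis ?x"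
          by (simp add: cis_mult inner_add_left)
        then show ?thesis
          unfolding cis_conv_exp[symmetric]
          by (simp add: algebra_simps inner_commute[of s h])
      qed
      then have "norm (?R s) = norm (f s) * norm (iexp ?x - (\<Sum>k\<le>1. (\<i> * ?x) ^ k / fact k))"
        by (simp add: norm_mult)
      also have "\<dots> \<le> norm (f s) * (\<bar>?x\<bar> ^ Suc 1 / fact (Suc 1))"
        by (intro mult_left_mono iexp_approx1) auto
      also have "\<dots> \<le> norm (f s) * (norm h * norm s) ^ 2"
      proof (intro mult_left_mono)
        have "\<bar>?x\<bar> ^ 2 \<le> (norm h * norm s) ^ 2"
          using Cauchy_Schwarz_ineq2[of h s] by (intro power_mono) auto
        moreover have "\<bar>?x\<bar> ^ Suc 1 / fact (Suc 1) \<le> \<bar>?x\<bar> ^ 2"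
          by (simp add: power2_eq_square)
        ultimately show "\<bar>?x\<bar> ^ Suc 1 / fact (Suc 1) \<le> (norm h * norm s) ^ 2" by linarith
      qed auto
      finally show "norm (?R s) \<le> (norm h)\<^sup>2 * (norm s ^ 2 * norm (f s))"
        by (simp add: power_mult_distrib mult_ac)
    qed
    also have "\<dots> = (norm h)\<^sup>2 * C" unfolding C_def by simp
    finally show ?thesis .
  qed
  show "((\<lambda>h. norm (fourier f (z + h) - fourier f z - ?D h) / norm h) \<longlongrightarrow> 0) (at 0)"
  proof (rule Lim_null_comparison)
    show "\<forall>\<^sub>F h in at 0. norm (norm (fourier f (z + h) - fourier f z - ?D h) / norm h) \<le> norm h * C"
    proof (rule eventually_at_filter[THEN iffD2], rule always_eventually, intro allI impI)
      fix h :: 'a assume "h \<noteq> 0"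
      then show "norm (norm (fourier f (z + h) - fourier f z - ?D h) / norm h) \<le> norm h * C"
        using bnd[of h] by (simp add: divide_le_eq power2_eq_square mult_ac)
    qed
    show "((\<lambda>h. norm h * C) \<longlongrightarrow> 0) (at (0::'a))"
      by (auto intro!: tendsto_eq_intros)
  qed
qed

text \<open>Averaging \<open>g (s + b) - g s = \<integral>\<^sub>0\<^sup>1 \<partial>\<^sub>b g (s + \<tau> b) d\<tau>\<close> over \<open>s\<close> and using translation
  invariance avoids any boundary terms.\<close>

lemma integral_directional_derivative_eq_0:
  fixes g :: "'a::euclidean_space \<Rightarrow> complex"
  assumes g': "\<And>x. (g has_derivative g' x) (at x)"
    and cont: "continuous_on UNIV (\<lambda>x. g' x b)"
    and gi: "integrable lborel g" and g'i: "integrable lborel (\<lambda>x. g' x b)"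
  shows "(LINT x|lborel. g' x b) = 0"
proof -
  define d where "d = (\<lambda>x. g' x b)"
  have [measurable]: "d \<in> borel_measurable borel" "g \<in> borel_measurable borel"
    using g'i gi by (auto simp: d_def)
  let ?I = "indicator {0..1::real} :: real \<Rightarrow> real"
  have Ii: "integrable lborel ?I" by simp
  have shift: "(LINT s|lborel. h (s + t)) = integral\<^sup>L lborel h"
    if "h \<in> borel_measurable borel" for h :: "'a \<Rightarrow> 'c::{banach, second_countable_topology}" and t
    using lborel_integral_translate[OF that, of t] by (simp add: add.commute)
  have shifti: "integrable lborel (\<lambda>s. h (s + t))"
    if "integrable lborel h" for h :: "'a \<Rightarrow> complex" and t
    using lborel_integrable_affine[of 1 h t] that by (simp add: add.commute)
  have FTC: "(LINT \<tau>|lborel. ?I \<tau> *\<^sub>R d (s + \<tau> *\<^sub>R b)) = g (s + b) - g s" for s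
  proof -
    have "(LINT \<tau>|lborel. ?I \<tau> *\<^sub>R d (s + \<tau> *\<^sub>R b)) = g (s + 1 *\<^sub>R b) - g (s + 0 *\<^sub>R b)"
    proof (rule integral_FTC_Icc)
      fix \<tau> :: real
      have "((\<lambda>\<tau>. s + \<tau> *\<^sub>R b) has_vector_derivative b) (at \<tau> within {0..1})"
        by (auto intro!: derivative_eq_intros)
      from vector_derivative_diff_chain_within[OF this has_derivative_at_withinI[OF g']]
      show "((\<lambda>\<tau>. g (s + \<tau> *\<^sub>R b)) has_vector_derivative d (s + \<tau> *\<^sub>R b)) (at \<tau> within {0..1})"
        by (simp add: o_def d_def)
    next
      show "continuous_on {0..1} (\<lambda>\<tau>. d (s + \<tau> *\<^sub>R b))"
        unfolding d_def
        by (rule continuous_on_compose2[OF cont]) (auto intro!: continuous_intros)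
    qed simp
    then show ?thesis by simp
  qed
  have int: "integrable (lborel \<Otimes>\<^sub>M lborel) (\<lambda>(\<tau>, s). ?I \<tau> *\<^sub>R d (s + \<tau> *\<^sub>R b))"
  proof (rule lborel_pair.Fubini_integrable)
    show "integrable lborel (\<lambda>\<tau>. LINT s|lborel. norm (case (\<tau>, s) of (\<tau>, s) \<Rightarrow> ?I \<tau> *\<^sub>R d (s + \<tau> *\<^sub>R b)))"
      using shift[of "\<lambda>s. norm (d s)"] by simp
    show "AE \<tau> in lborel. integrable lborel (\<lambda>s. case (\<tau>, s) of (\<tau>, s) \<Rightarrow> ?I \<tau> *\<^sub>R d (s + \<tau> *\<^sub>R b))"
      using shifti[OF g'i] by (simp add: d_def)
  qed measurable
  have "0 = (LINT s|lborel. g (s + b)) - (LINT s|lborel. g s)"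
    by (simp add: shift)
  also have "\<dots> = (LINT s|lborel. g (s + b) - g s)"
    by (intro Bochner_Integration.integral_diff[symmetric] shifti gi)
  also have "\<dots> = (LINT s|lborel. LINT \<tau>|lborel. ?I \<tau> *\<^sub>R d (s + \<tau> *\<^sub>R b))"
    by (simp only: FTC)
  also have "\<dots> = (LINT \<tau>|lborel. LINT s|lborel. ?I \<tau> *\<^sub>R d (s + \<tau> *\<^sub>R b))"
    by (rule lborel_pair.Fubini_integral[OF int])
  also have "\<dots> = (LINT \<tau>|lborel. ?I \<tau> *\<^sub>R integral\<^sup>L lborel d)"
    by (simp add: shift)
  also have "\<dots> = integral\<^sup>L lborel d" by simp
  finally show ?thesis unfolding d_def by simp
qed

text \<open>Integration by parts in the form that the integral of the b-derivative of f(x) exp(-i z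
  . x) is zero; the product rule splits that derivative into the two terms compared here.\<close>

lemma fourier_pderiv:
  fixes f :: "'a::euclidean_space \<Rightarrow> complex"
  assumes f: "f \<in> schwartz" and b: "b \<in> Basis"
  shows "fourier (\<lambda>x. frechet_derivative f (at x) b) z = \<i> * complex_of_real (z \<bullet> b) * fourier f z"
proof -
  define fb where "fb = (\<lambda>x. frechet_derivative f (at x) b)"
  have fb: "fb \<in> schwartz" unfolding fb_def by (rule schwartz_pderiv[OF f b])
  define g' where "g' = (\<lambda>x v. f x * (\<i> * complex_of_real (- (z \<bullet> v)) * cis (- (z \<bullet> x))) +
      frechet_derivative f (at x) v * cis (- (z \<bullet> x)))"
  have i1: "integrable lborel (\<lambda>x. (\<i> * complex_of_real (- (z \<bullet> b))) * (f x * cis (- (z \<bullet> x))))"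
    by (intro integrable_mult_right integrable_mult_cis schwartz_integrable f) auto
  have i2: "integrable lborel (\<lambda>x. fb x * cis (- (z \<bullet> x)))"
    by (intro integrable_mult_cis schwartz_integrable fb) auto
  have eq: "(\<lambda>x. g' x b) = (\<lambda>x. (\<i> * complex_of_real (- (z \<bullet> b))) * (f x * cis (- (z \<bullet> x))) + fb x * cis (- (z \<bullet> x)))"
    unfolding g'_def fb_def by (auto simp: fun_eq_iff)
  have "(LINT x|lborel. g' x b) = 0"
  proof (rule integral_directional_derivative_eq_0)
    fix x
    have "((\<lambda>x. - (z \<bullet> x)) has_derivative (\<lambda>v. - (z \<bullet> v))) (at x)"
      by (auto intro!: derivative_eq_intros)
    from has_derivative_mult[OF schwartz_has_derivative[OF f] has_derivative_cis[OF this]]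
    show "((\<lambda>x. f x * cis (- (z \<bullet> x))) has_derivative g' x) (at x)"
      unfolding g'_def .
  next
    show "continuous_on UNIV (\<lambda>x. g' x b)"
      unfolding eq by (intro continuous_intros schwartz_continuous_on f fb)
    show "integrable lborel (\<lambda>x. f x * cis (- (z \<bullet> x)))"
      by (intro integrable_mult_cis schwartz_integrable f) auto
    show "integrable lborel (\<lambda>x. g' x b)"
      unfolding eq by (intro Bochner_Integration.integrable_add i1 i2)
  qed
  then have "(\<i> * complex_of_real (- (z \<bullet> b))) * fourier f z + fourier fb z = 0"
    unfolding eq fourier_cis
    by (simp only: Bochner_Integration.integral_add[OF i1 i2] integral_mult_right_zero)
  then show ?thesis unfolding fb_def by (simp add: add_eq_0_iff2)
qed

text \<open>One factor |z| is at most the sum of the |z . b|, and each z . b is traded for a partial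
  derivative of f. The induction therefore runs over all Schwartz functions at once and ends with
  the L1 bound.\<close>

lemma fourier_power_bound:
  fixes f :: "'a::euclidean_space \<Rightarrow> complex"
  assumes "f \<in> schwartz"
  shows "\<exists>C. \<forall>z. norm z ^ n * norm (fourier f z) \<le> C"
  using assms
proof (induction n arbitrary: f)
  case 0
  then show ?case using norm_fourier_le[of f] by auto
next
  case (Suc n)
  have "\<forall>b\<in>Basis. \<exists>C. \<forall>z. norm z ^ n * norm (fourier (\<lambda>x. frechet_derivative f (at x) b) z) \<le> C"
    using Suc.IH[OF schwartz_pderiv[OF Suc.prems]] by blast
  then obtain C where C: "\<And>b z. b \<in> Basis \<Longrightarrow>
      norm z ^ n * norm (fourier (\<lambda>x. frechet_derivative f (at x) b) z) \<le> C b"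
    by metis
  have "norm z ^ Suc n * norm (fourier f z) \<le> sum C Basis" for z
  proof -
    have "norm z ^ Suc n * norm (fourier f z) \<le> (\<Sum>b\<in>Basis. \<bar>z \<bullet> b\<bar>) * (norm z ^ n * norm (fourier f z))"
      using mult_right_mono[OF norm_le_l1[of z], of "norm z ^ n * norm (fourier f z)"] by (simp add: mult_ac)
    also have "\<dots> = (\<Sum>b\<in>Basis. norm z ^ n * norm (fourier (\<lambda>x. frechet_derivative f (at x) b) z))"
      unfolding sum_distrib_right
      by (intro sum.cong refl) (simp add: fourier_pderiv[OF Suc.prems] norm_mult mult_ac)
    also have "\<dots> \<le> sum C Basis" by (intro sum_mono C)
    finally show ?thesis .
  qed
  then show ?case by blast
qed

text \<open>The image of the whole Schwartz space serves as the invariant set: a partial derivative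
  of a transform is the transform of a Schwartz function multiplied by a coordinate.\<close>

theorem schwartz_fourier:
  fixes f :: "'a::euclidean_space \<Rightarrow> complex"
  assumes f: "f \<in> schwartz"
  shows "fourier f \<in> schwartz"
proof (rule schwartzI[of _ "fourier ` schwartz"])
  show "fourier f \<in> fourier ` schwartz" using f by blast
next
  fix g :: "'a \<Rightarrow> complex" and x assume "g \<in> fourier ` schwartz"
  then show "g differentiable at x"
    using fourier_has_derivative differentiable_def by blast
next
  fix g :: "'a \<Rightarrow> complex" assume "g \<in> fourier ` schwartz"
  then show "rapidly_decreasing g"
    using fourier_power_bound unfolding rapidly_decreasing_def by blast
next
  fix g :: "'a \<Rightarrow> complex" and b :: 'a assume "g \<in> fourier ` schwartz" "b \<in> Basis"
  then obtain f where f: "f \<in> schwartz" "g = fourier f" by blast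
  have "(\<lambda>x. frechet_derivative g (at x) b) = fourier (\<lambda>s. - \<i> * (complex_of_real (s \<bullet> b) * f s))"
    unfolding f(2) by (rule frechet_derivative_eq[OF fourier_has_derivative[OF f(1)]])
  then show "(\<lambda>x. frechet_derivative g (at x) b) \<in> fourier ` schwartz"
    using schwartz_cmult[OF schwartz_inner_mult[OF f(1)]] by blast
qed

section \<open>Inversion on the Schwartz space and decay at infinity\<close>

lemma schwartz_uminus: "f \<in> schwartz \<Longrightarrow> (\<lambda>x. f (- x)) \<in> schwartz"
  using schwartz_scale[of f "-1"] by simp

lemma schwartz_inv_fourier: "f \<in> schwartz \<Longrightarrow> inv_fourier f \<in> schwartz"
  unfolding inv_fourier_eq_fourier[abs_def]
  by (intro schwartz_cmult schwartz_uminus schwartz_fourier)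

lemma schwartz_bounded:
  assumes "f \<in> schwartz"
  obtains B where "\<And>x. norm (f x) \<le> B"
  using rapidly_decreasingE[OF schwartz_rapidly_decreasing[OF assms], of 0] by auto

lemma two_pi_powr_uminus: "(2 * pi) powr (- real n) * (2 * pi) ^ n = 1"
proof -
  have "(2 * pi) ^ n = (2 * pi) powr real n" by (rule powr_realpow[symmetric]) simp
  then show ?thesis by (simp only: powr_add[symmetric]) simp
qed

lemma schwartz_inversion:
  fixes f :: "'a::euclidean_space \<Rightarrow> complex"
  assumes f: "f \<in> schwartz"
  shows "complex_of_real ((2 * pi) powr (- real DIM('a))) * (LINT z|lborel. fourier f z * cis (s \<bullet> z)) = f s"
proof -
  obtain B where B: "\<And>x. norm (f x) \<le> B" using schwartz_bounded[OF f] by blast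
  have "complex_of_real ((2 * pi) powr (- real DIM('a))) * (LINT z|lborel. fourier f z * cis (s \<bullet> z)) =
     complex_of_real ((2 * pi) powr (- real DIM('a)) * (2 * pi) ^ DIM('a)) * f s"
    by (subst fourier_inversion[OF schwartz_integrable[OF f] schwartz_integrable[OF schwartz_fourier[OF f]]
          schwartz_continuous_on[OF f] B]) simp
  then show ?thesis by (simp only: two_pi_powr_uminus of_real_1 mult_1)
qed

lemma inv_fourier_fourier: "f \<in> schwartz \<Longrightarrow> inv_fourier (fourier f) = f"
  using schwartz_inversion by (auto simp: fun_eq_iff inv_fourier_cis)

text \<open>The inverse transform is a reflected and rescaled transform, so reflecting the
  integration variable reduces this order of composition to the same inversion formula.\<close>

lemma fourier_inv_fourier:
  assumes f: "f \<in> schwartz"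
  shows "fourier (inv_fourier f) = f"
proof
  fix z
  have [measurable]: "fourier f \<in> borel_measurable borel"
    by (intro schwartz_measurable schwartz_fourier f)
  have "fourier (inv_fourier f) z = complex_of_real ((2 * pi) powr (- real DIM('a))) *
      (LINT s|lborel. fourier f (- s) * cis (z \<bullet> (- s)))"
    unfolding fourier_cis[of "inv_fourier f"] inv_fourier_eq_fourier
    by (simp add: mult.assoc)
  also have "(LINT s|lborel. fourier f (- s) * cis (z \<bullet> (- s))) = (LINT s|lborel. fourier f s * cis (z \<bullet> s))"
    by (rule lborel_integral_uminus) measurable
  also have "complex_of_real ((2 * pi) powr (- real DIM('a))) * \<dots> = f z"
    by (rule schwartz_inversion[OF f])
  finally show "fourier (inv_fourier f) z = f z" .
qed

text \<open>Makes the limit at infinity in \<open>N_F\<close> recover the constant -phi(0).\<close>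

lemma schwartz_tendsto_0:
  assumes f: "f \<in> schwartz"
  shows "(f \<longlongrightarrow> 0) at_infinity"
proof -
  obtain C where C: "\<And>x. norm x ^ 1 * norm (f x) \<le> C"
    using rapidly_decreasingE[OF schwartz_rapidly_decreasing[OF f]] by blast
  show ?thesis
  proof (rule Lim_null_comparison)
    show "\<forall>\<^sub>F x in at_infinity. norm (f x) \<le> C * inverse (norm x)"
      unfolding eventually_at_infinity
    proof (intro exI[of _ 1] allI impI)
      fix x :: 'a assume "1 \<le> norm x"
      then have "norm x > 0" by linarith
      then show "norm (f x) \<le> C * inverse (norm x)"
        using C[of x] by (simp add: field_simps)
    qed
    show "((\<lambda>x. C * inverse (norm x)) \<longlongrightarrow> 0) (at_infinity :: 'a filter)"
      using tendsto_inverse_0_at_top[OF filterlim_norm_at_top]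
      by (intro tendsto_mult_right_zero)
  qed
qed


section \<open>The spanning problem\<close>

text \<open>Rounding k down to the grid of mesh 1/(n+1) leaves countably many values of k, and for
  each of them F is continuous in x, so the rounded function is jointly measurable. Continuity in k
  makes F its pointwise limit.\<close>

lemma separately_continuous_measurable:
  fixes F :: "'a::euclidean_space \<Rightarrow> real \<Rightarrow> 'b::{real_normed_vector, second_countable_topology}"
  assumes cx: "\<And>k. continuous_on UNIV (\<lambda>x. F x k)" and ck: "\<And>x. continuous_on UNIV (F x)"
  shows "(\<lambda>(x, k). F x k) \<in> borel_measurable (borel \<Otimes>\<^sub>M borel)"
proof -
  define q where "q = (\<lambda>n (k::real). real_of_int \<lfloor>real (Suc n) * k\<rfloor> / real (Suc n))"
  have meas: "(\<lambda>p. F (fst p) (q n (snd p))) \<in> borel_measurable (borel \<Otimes>\<^sub>M borel)" for n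
    unfolding q_def
  proof (rule measurable_compose_countable[where f = "\<lambda>i p. F (fst p) (real_of_int i / real (Suc n))"])
    fix i :: int
    have [measurable]: "(\<lambda>x. F x (real_of_int i / real (Suc n))) \<in> borel_measurable borel"
      by (intro borel_measurable_continuous_onI cx)
    show "(\<lambda>p. F (fst p) (real_of_int i / real (Suc n))) \<in> borel_measurable (borel \<Otimes>\<^sub>M borel)"
      by measurable
  qed measurable
  have lim: "(\<lambda>n. F x (q n k)) \<longlonglongrightarrow> F x k" for x k
  proof -
    have "(\<lambda>n. q n k - k) \<longlonglongrightarrow> 0"
    proof (rule Lim_null_comparison)
      show "\<forall>\<^sub>F n in sequentially. norm (q n k - k) \<le> inverse (real (Suc n))"
      proof (intro always_eventually allI)
        fix n
        have "\<bar>real_of_int \<lfloor>real (Suc n) * k\<rfloor> - real (Suc n) * k\<bar> \<le> 1" by linarith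
        then have "\<bar>real_of_int \<lfloor>real (Suc n) * k\<rfloor> - real (Suc n) * k\<bar> / real (Suc n) \<le> 1 / real (Suc n)"
          by (intro divide_right_mono) auto
        moreover have "norm (q n k - k) = \<bar>real_of_int \<lfloor>real (Suc n) * k\<rfloor> - real (Suc n) * k\<bar> / real (Suc n)"
        proof -
          have "q n k - k = (real_of_int \<lfloor>real (Suc n) * k\<rfloor> - real (Suc n) * k) / real (Suc n)"
            unfolding q_def by (simp add: diff_divide_distrib del: of_nat_Suc)
          then show ?thesis by simp
        qed
        ultimately show "norm (q n k - k) \<le> inverse (real (Suc n))"
          by (simp add: inverse_eq_divide)
      qed
    qed (rule LIMSEQ_inverse_real_of_nat)
    then have "(\<lambda>n. q n k) \<longlonglongrightarrow> k" using Lim_null by blast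
    then show ?thesis
      using continuous_on_tendsto_compose[OF ck] by simp
  qed
  have "(\<lambda>p. F (fst p) (snd p)) \<in> borel_measurable (borel \<Otimes>\<^sub>M borel)"
    by (rule borel_measurable_LIMSEQ_metric[OF meas]) (rule lim)
  then show ?thesis by (simp add: case_prod_beta')
qed

text \<open>The zero set is closed and has full Lebesgue measure, hence is everything.\<close>

lemma continuous_AE_eq_0_imp_eq_0:
  fixes f :: "'a::euclidean_space \<Rightarrow> real"
  assumes "continuous_on UNIV f" "AE x in lborel. f x = 0"
  shows "f x = 0"
proof -
  have "closed {x. f x = 0}"
    by (intro closed_Collect_eq assms(1) continuous_intros)
  moreover have "AE x in lebesgue. x \<in> {x. f x = 0}"
    using AE_completion[OF assms(2)] by simp
  ultimately show ?thesis
    using mem_closed_if_AE_lebesgue by blast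
qed

lemma assumption_A_measurable:
  assumes "assumption_A F"
  shows "(\<lambda>(x, k). F x k) \<in> borel_measurable (borel \<Otimes>\<^sub>M borel)"
  using assms unfolding assumption_A_def by (intro separately_continuous_measurable) auto

section \<open>Pairings with test functions and their behaviour under dilation\<close>

lemma theta0_cis: "theta0 r h x k = cis (- (r * k)) * h x"
  by (simp add: theta0_def cis_conv_exp)

text \<open>The kernel is left free: F gives the left side of the problem and \<open>tent w\<close>
  the spanned function, so one substitution lemma serves both.\<close>

definition pairing :: "('a::euclidean_space \<Rightarrow> real \<Rightarrow> real) \<Rightarrow> real \<Rightarrow> ('a \<Rightarrow> complex) \<Rightarrow> complex" where
  "pairing G r h = (LINT x|lborel. LINT k|lborel. complex_of_real (G x k) * theta0 r h x k)"

definition tent :: "'a::euclidean_space \<Rightarrow> 'a \<Rightarrow> real \<Rightarrow> real" where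
  "tent w x k = max 0 (\<bar>w \<bullet> x\<bar> - \<bar>k\<bar>)"

lemma tent_measurable: "(\<lambda>(x, k). tent w x k) \<in> borel_measurable (borel \<Otimes>\<^sub>M borel)"
  unfolding tent_def by measurable

lemma solves_P_pairing:
  "solves_P F N \<longleftrightarrow> linear_form_on Sigma_e N \<and>
    (\<forall>r h. r \<noteq> 0 \<longrightarrow> h \<in> schwartz \<longrightarrow> pairing F r h = N (\<lambda>w. pairing (tent w) r h))"
  unfolding solves_P_def pairing_def tent_def ..

text \<open>The exponent \<open>d + 2\<close> absorbs the Jacobians \<open>\<bar>c\<bar>\<^sup>d\<close> in \<open>x\<close> and \<open>\<bar>c\<bar>\<close> in \<open>k\<close> and the degree 1 of
  \<open>tent\<close>.\<close>

definition dilate :: "real \<Rightarrow> ('a::euclidean_space \<Rightarrow> complex) \<Rightarrow> 'a \<Rightarrow> complex" where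
  "dilate c h y = complex_of_real (inverse (\<bar>c\<bar> ^ (DIM('a) + 2))) * h (inverse c *\<^sub>R y)"

lemma schwartz_dilate: "h \<in> schwartz \<Longrightarrow> c \<noteq> 0 \<Longrightarrow> dilate c h \<in> schwartz"
  unfolding dilate_def[abs_def] by (intro schwartz_cmult schwartz_scale) auto

text \<open>A change of variables in k and in x that asks only for measurability, so it applies to
  \<open>tent\<close> without an integrability proof. The scalings m and c share only their absolute
  value; their independent signs are what later yields the two reflection symmetries.\<close>

lemma pairing_dilate:
  fixes G :: "'a::euclidean_space \<Rightarrow> real \<Rightarrow> real"
  assumes G [measurable]: "(\<lambda>(x, k). G x k) \<in> borel_measurable (borel \<Otimes>\<^sub>M borel)"
    and h [measurable]: "h \<in> borel_measurable borel"
    and c: "c \<noteq> 0" and m: "\<bar>m\<bar> = \<bar>c\<bar>"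
  shows "pairing G (r / m) (dilate c h) = pairing (\<lambda>x k. inverse \<bar>c\<bar> * G (c *\<^sub>R x) (m * k)) r h"
proof -
  have m0: "m \<noteq> 0" using c m by auto
  have dm [measurable]: "dilate c h \<in> borel_measurable borel"
    unfolding dilate_def[abs_def] by measurable
  have inner: "(LINT k|lborel. complex_of_real (G y k) * theta0 (r / m) (dilate c h) y k) =
      \<bar>c\<bar> *\<^sub>R (LINT k|lborel. complex_of_real (G y (m * k)) * (cis (- (r * k)) * dilate c h y))" for y
  proof -
    have "(LINT k|lborel. complex_of_real (G y k) * theta0 (r / m) (dilate c h) y k) =
       \<bar>m\<bar> *\<^sub>R (LINT k|lborel. complex_of_real (G y (0 + m * k)) * theta0 (r / m) (dilate c h) y (0 + m * k))"
      by (rule lborel_integral_real_affine[OF m0])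
    then show ?thesis using m0 by (simp add: theta0_cis m)
  qed
  have "pairing G (r / m) (dilate c h) =
      (LINT y|lborel. \<bar>c\<bar> *\<^sub>R (LINT k|lborel. complex_of_real (G y (m * k)) * (cis (- (r * k)) * dilate c h y)))"
    unfolding pairing_def inner ..
  also have "\<dots> = \<bar>c\<bar> ^ DIM('a) *\<^sub>R (LINT x|lborel. \<bar>c\<bar> *\<^sub>R (LINT k|lborel. complex_of_real (G (0 + c *\<^sub>R x) (m * k)) *
      (cis (- (r * k)) * dilate c h (0 + c *\<^sub>R x))))"
  proof (rule lborel_integral_affine[OF c])
    have "(\<lambda>y. \<bar>c\<bar> *\<^sub>R (LINT k|lborel. complex_of_real (G y (m * k)) * (cis (- (r * k)) * dilate c h y)))
      \<in> borel_measurable lborel" by measurable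
    then show "(\<lambda>y. \<bar>c\<bar> *\<^sub>R (LINT k|lborel. complex_of_real (G y (m * k)) * (cis (- (r * k)) * dilate c h y)))
      \<in> borel_measurable borel" by simp
  qed
  also have "\<dots> = (LINT x|lborel. LINT k|lborel. complex_of_real (\<bar>c\<bar> ^ (DIM('a) + 1)) *
      (complex_of_real (G (c *\<^sub>R x) (m * k)) * (cis (- (r * k)) * dilate c h (c *\<^sub>R x))))"
    unfolding integral_mult_right_zero by (simp add: scaleR_conv_of_real mult_ac)
  also have "\<dots> = pairing (\<lambda>x k. inverse \<bar>c\<bar> * G (c *\<^sub>R x) (m * k)) r h"
    unfolding pairing_def
  proof (intro Bochner_Integration.integral_cong refl)
    fix x k
    \<comment> \<open>The d + 1 Jacobian factors against the exponent d + 2 leave a single 1/|c|,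
      matched to kernels of degree 1.\<close>
    have "\<bar>c\<bar> ^ (DIM('a) + 1) * inverse (\<bar>c\<bar> ^ (DIM('a) + 2)) = inverse \<bar>c\<bar>"
      using c by (simp add: field_simps)
    then have "complex_of_real (\<bar>c\<bar> ^ (DIM('a) + 1)) * complex_of_real (inverse (\<bar>c\<bar> ^ (DIM('a) + 2))) =
        complex_of_real (inverse \<bar>c\<bar>)"
      unfolding of_real_mult[symmetric] by (simp only:)
    moreover have "dilate c h (c *\<^sub>R x) = complex_of_real (inverse (\<bar>c\<bar> ^ (DIM('a) + 2))) * h x"
      using c by (simp add: dilate_def)
    ultimately show "complex_of_real (\<bar>c\<bar> ^ (DIM('a) + 1)) *
        (complex_of_real (G (c *\<^sub>R x) (m * k)) * (cis (- (r * k)) * dilate c h (c *\<^sub>R x))) =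
        complex_of_real (inverse \<bar>c\<bar> * G (c *\<^sub>R x) (m * k)) * theta0 r h x k"
      unfolding theta0_cis of_real_mult by (simp only: mult_ac)
  qed
  finally show ?thesis .
qed

lemma tent_dilate:
  assumes c: "c \<noteq> 0" and m: "\<bar>m\<bar> = \<bar>c\<bar>"
  shows "inverse \<bar>c\<bar> * tent w (c *\<^sub>R x) (m * k) = tent w x k"
proof -
  have "\<bar>w \<bullet> (c *\<^sub>R x)\<bar> - \<bar>m * k\<bar> = \<bar>c\<bar> * (\<bar>w \<bullet> x\<bar> - \<bar>k\<bar>)"
    by (simp add: abs_mult m right_diff_distrib)
  moreover have "max 0 (\<bar>c\<bar> * t) = \<bar>c\<bar> * max 0 t" for t
    using c by (auto simp: max_def zero_le_mult_iff)
  ultimately show ?thesis using c unfolding tent_def by simp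
qed

lemma pairing_tent_dilate:
  assumes "h \<in> schwartz" "c \<noteq> 0" "\<bar>m\<bar> = \<bar>c\<bar>"
  shows "pairing (tent w) (r / m) (dilate c h) = pairing (tent w) r h"
  by (subst pairing_dilate[OF tent_measurable schwartz_measurable[OF assms(1)] assms(2,3)])
     (simp only: tent_dilate[OF assms(2,3)])

section \<open>Pairings under Assumption (A) and their injectivity in the kernel\<close>

lemma assumption_A_integrable:
  assumes A: "assumption_A F" and h: "h \<in> schwartz"
  shows "integrable (lborel \<Otimes>\<^sub>M lborel) (\<lambda>(x, k). complex_of_real (F x k) * theta0 r h x k)"
proof (rule integrableI_bounded)
  have [measurable]: "h \<in> borel_measurable borel" by (rule schwartz_measurable[OF h])
  have [measurable]: "(\<lambda>(x, k). F x k) \<in> borel_measurable (borel \<Otimes>\<^sub>M borel)"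
    by (rule assumption_A_measurable[OF A])
  show m: "(\<lambda>(x, k). complex_of_real (F x k) * theta0 r h x k) \<in> borel_measurable (lborel \<Otimes>\<^sub>M lborel)"
    unfolding theta0_cis by measurable
  have "(\<integral>\<^sup>+ p. ennreal (norm (case p of (x, k) \<Rightarrow> complex_of_real (F x k) * theta0 r h x k)) \<partial>(lborel \<Otimes>\<^sub>M lborel)) =
      (\<integral>\<^sup>+ x. \<integral>\<^sup>+ k. ennreal (norm (case (x, k) of (x, k) \<Rightarrow> complex_of_real (F x k) * theta0 r h x k)) \<partial>lborel \<partial>lborel)"
    by (rule lborel.nn_integral_fst[symmetric]) (rule measurable_compose[OF measurable_compose[OF m borel_measurable_norm] measurable_ennreal])
  also have "\<dots> = (\<integral>\<^sup>+ x. \<integral>\<^sup>+ k. ennreal (norm (complex_of_real (F x k) * h x)) \<partial>lborel \<partial>lborel)"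
    by (simp add: theta0_cis norm_mult)
  also have "\<dots> < \<infinity>" using A h unfolding assumption_A_def by blast
  finally show "(\<integral>\<^sup>+ p. ennreal (norm (case p of (x, k) \<Rightarrow> complex_of_real (F x k) * theta0 r h x k)) \<partial>(lborel \<Otimes>\<^sub>M lborel)) < \<infinity>" .
qed

text \<open>Linearity in h is read off from a single integral over the product, which avoids
  tracking the null set of x where an inner integral may fail to exist.\<close>

lemma pairing_eq_pair_integral:
  assumes "assumption_A F" "h \<in> schwartz"
  shows "pairing F r h = (LINT p|(lborel \<Otimes>\<^sub>M lborel). (case p of (x, k) \<Rightarrow> complex_of_real (F x k) * theta0 r h x k))"
  unfolding pairing_def by (rule lborel_pair.integral_fst[OF assumption_A_integrable[OF assms]])

lemma pairing_lincomb:
  assumes A: "assumption_A F" and f: "f \<in> schwartz" and g: "g \<in> schwartz"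
  shows "pairing F r (\<lambda>x. a * f x + b * g x) = a * pairing F r f + b * pairing F r g"
proof -
  have "pairing F r (\<lambda>x. a * f x + b * g x) = (LINT p|(lborel \<Otimes>\<^sub>M lborel).
      a * (case p of (x, k) \<Rightarrow> complex_of_real (F x k) * theta0 r f x k) +
      b * (case p of (x, k) \<Rightarrow> complex_of_real (F x k) * theta0 r g x k))"
    unfolding pairing_eq_pair_integral[OF A schwartz_lincomb[OF f g]]
    by (intro Bochner_Integration.integral_cong refl) (auto simp: theta0_cis algebra_simps)
  also have "\<dots> = a * pairing F r f + b * pairing F r g"
    unfolding pairing_eq_pair_integral[OF A f] pairing_eq_pair_integral[OF A g]
    by (simp only: Bochner_Integration.integral_add[OF integrable_mult_right[OF assumption_A_integrable[OF A f]]
          integrable_mult_right[OF assumption_A_integrable[OF A g]]] integral_mult_right_zero)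
  finally show ?thesis .
qed

text \<open>Lets the rescaled kernel be compared with F by \<open>pairing_inject\<close>, which
  needs the assumption for both.\<close>

lemma assumption_A_dilate:
  fixes F :: "'a::euclidean_space \<Rightarrow> real \<Rightarrow> real"
  assumes A: "assumption_A F" and c: "c \<noteq> 0" and m: "m \<noteq> 0"
  shows "assumption_A (\<lambda>x k. a * F (c *\<^sub>R x) (m * k))"
  unfolding assumption_A_def
proof (intro conjI allI ballI)
  fix k
  have "continuous_on UNIV (\<lambda>x. F x (m * k))" using A unfolding assumption_A_def by blast
  then show "continuous_on UNIV (\<lambda>x. a * F (c *\<^sub>R x) (m * k))"
    by (intro continuous_intros) (rule continuous_on_compose2, auto intro!: continuous_intros)
next
  fix x
  have "continuous_on UNIV (F (c *\<^sub>R x))" using A unfolding assumption_A_def by blast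
  then show "continuous_on UNIV (\<lambda>k. a * F (c *\<^sub>R x) (m * k))"
    by (intro continuous_intros) (rule continuous_on_compose2, auto intro!: continuous_intros)
next
  fix h :: "'a \<Rightarrow> complex" assume h: "h \<in> schwartz"
  \<comment> \<open>The test function is chosen so that substituting y = c x turns it into a times
    h(x): one instance of the assumption for F then gives the bound for the rescaled kernel.\<close>
  let ?h = "\<lambda>y. complex_of_real a * h (inverse c *\<^sub>R y)"
  have hs: "?h \<in> schwartz" using h c by (intro schwartz_cmult schwartz_scale) auto
  have [measurable]: "?h \<in> borel_measurable borel" by (rule schwartz_measurable[OF hs])
  have [measurable]: "(\<lambda>(x, k). F x k) \<in> borel_measurable (borel \<Otimes>\<^sub>M borel)"
    by (rule assumption_A_measurable[OF A])
  let ?g = "\<lambda>y k. ennreal (norm (complex_of_real (F y k) * ?h y))"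
  have "(\<integral>\<^sup>+y. \<integral>\<^sup>+k. ?g y k \<partial>lborel \<partial>lborel) < \<infinity>"
    using bspec[OF conjunct2[OF conjunct2[OF A[unfolded assumption_A_def]]] hs] .
  also have "(\<integral>\<^sup>+y. \<integral>\<^sup>+k. ?g y k \<partial>lborel \<partial>lborel) =
      (\<integral>\<^sup>+y. ennreal \<bar>m\<bar> * (\<integral>\<^sup>+k. ?g y (m * k) \<partial>lborel) \<partial>lborel)"
  proof (rule nn_integral_cong)
    fix y
    show "(\<integral>\<^sup>+k. ?g y k \<partial>lborel) = ennreal \<bar>m\<bar> * (\<integral>\<^sup>+k. ?g y (m * k) \<partial>lborel)"
      using nn_integral_real_affine[OF _ m, of "?g y" 0] by simp
  qed
  also have "\<dots> = ennreal (\<bar>c\<bar> ^ DIM('a)) *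
      (\<integral>\<^sup>+x. ennreal \<bar>m\<bar> * (\<integral>\<^sup>+k. ?g (0 + c *\<^sub>R x) (m * k) \<partial>lborel) \<partial>lborel)"
  proof (rule lborel_nn_integral_affine[OF c])
    have "(\<lambda>y. ennreal \<bar>m\<bar> * (\<integral>\<^sup>+k. ?g y (m * k) \<partial>lborel)) \<in> borel_measurable lborel"
      by measurable
    then show "(\<lambda>y. ennreal \<bar>m\<bar> * (\<integral>\<^sup>+k. ?g y (m * k) \<partial>lborel)) \<in> borel_measurable borel" by simp
  qed
  also have "\<dots> = ennreal (\<bar>c\<bar> ^ DIM('a)) * (ennreal \<bar>m\<bar> * (\<integral>\<^sup>+x. \<integral>\<^sup>+k. ?g (c *\<^sub>R x) (m * k) \<partial>lborel \<partial>lborel))"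
  proof -
    have "(\<lambda>x. \<integral>\<^sup>+k. ?g (c *\<^sub>R x) (m * k) \<partial>lborel) \<in> borel_measurable lborel" by measurable
    then show ?thesis by (simp add: nn_integral_cmult)
  qed
  finally have "(\<integral>\<^sup>+x. \<integral>\<^sup>+k. ?g (c *\<^sub>R x) (m * k) \<partial>lborel \<partial>lborel) < \<infinity>"
    using c m by (auto simp: ennreal_mult_less_top)
  also have "(\<integral>\<^sup>+x. \<integral>\<^sup>+k. ?g (c *\<^sub>R x) (m * k) \<partial>lborel \<partial>lborel) =
      (\<integral>\<^sup>+x. \<integral>\<^sup>+k. ennreal (norm (complex_of_real (a * F (c *\<^sub>R x) (m * k)) * h x)) \<partial>lborel \<partial>lborel)"
    using c by (simp add: mult_ac)
  finally show "(\<integral>\<^sup>+x. \<integral>\<^sup>+k. ennreal (norm (complex_of_real (a * F (c *\<^sub>R x) (m * k)) * h x)) \<partial>lborel \<partial>lborel) < \<infinity>" .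
qed

lemma pairing_inject:
  fixes F F' :: "'a::euclidean_space \<Rightarrow> real \<Rightarrow> real"
  assumes A: "assumption_A F" and A': "assumption_A F'"
    and eq: "\<And>r h. r \<noteq> 0 \<Longrightarrow> h \<in> schwartz \<Longrightarrow> pairing F r h = pairing F' r h"
  shows "F x k = F' x k"
proof -
  define D where "D = (\<lambda>x k. F x k - F' x k)"
  define H :: "'a \<times> real \<Rightarrow> complex" where "H = (\<lambda>(x, k). complex_of_real (D x k) * theta0 0 (modulated_gaussian 0) x k)"
  have H_eq: "H p = (case p of (x, k) \<Rightarrow> complex_of_real (F x k) * theta0 0 (modulated_gaussian 0) x k) -
      (case p of (x, k) \<Rightarrow> complex_of_real (F' x k) * theta0 0 (modulated_gaussian 0) x k)" for p
    by (auto simp: H_def D_def algebra_simps split: prod.split)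
  have "integrable (lborel \<Otimes>\<^sub>M lborel) H"
    unfolding H_eq[abs_def]
    by (intro Bochner_Integration.integrable_diff assumption_A_integrable A A' modulated_gaussian_schwartz)
  then have Hi: "integrable lborel H" by (simp add: lborel_prod)
  have "fourier H (\<xi>, r) = 0" if "r \<noteq> 0" for \<xi> r
  proof -
    have "fourier H (\<xi>, r) = (LINT p|(lborel \<Otimes>\<^sub>M lborel). H p * cis (- ((\<xi>, r) \<bullet> p)))"
      unfolding fourier_cis by (simp add: lborel_prod)
    also have "\<dots> = (LINT p|(lborel \<Otimes>\<^sub>M lborel).
        (case p of (x, k) \<Rightarrow> complex_of_real (F x k) * theta0 r (modulated_gaussian (- \<xi>)) x k) -
        (case p of (x, k) \<Rightarrow> complex_of_real (F' x k) * theta0 r (modulated_gaussian (- \<xi>)) x k))"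
    proof (intro Bochner_Integration.integral_cong refl)
      fix p :: "'a \<times> real"
      obtain x k where p: "p = (x, k)" by (cases p)
      \<comment> \<open>The character on the product space splits into a k-part, which is the
        frequency of \<open>theta0\<close>, and an x-part, which modulates the Gaussian.\<close>
      have "cis (- ((\<xi>, r) \<bullet> p)) = cis (- (r * k)) * cis (x \<bullet> - \<xi>)"
        unfolding p cis_mult by (simp add: inner_commute algebra_simps)
      then show "H p * cis (- ((\<xi>, r) \<bullet> p)) =
        (case p of (x, k) \<Rightarrow> complex_of_real (F x k) * theta0 r (modulated_gaussian (- \<xi>)) x k) -
        (case p of (x, k) \<Rightarrow> complex_of_real (F' x k) * theta0 r (modulated_gaussian (- \<xi>)) x k)"
        by (simp add: p H_def D_def theta0_cis modulated_gaussian_cis algebra_simps)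
    qed
    also have "\<dots> = pairing F r (modulated_gaussian (- \<xi>)) - pairing F' r (modulated_gaussian (- \<xi>))"
      unfolding pairing_eq_pair_integral[OF A modulated_gaussian_schwartz]
        pairing_eq_pair_integral[OF A' modulated_gaussian_schwartz]
      by (intro Bochner_Integration.integral_diff assumption_A_integrable A A' modulated_gaussian_schwartz)
    also have "\<dots> = 0" using eq[OF that modulated_gaussian_schwartz] by simp
    finally show ?thesis .
  qed
  \<comment> \<open>The excluded frequencies r = 0 form a hyperplane, hence a null set.\<close>
  moreover have "AE z in lborel. z \<bullet> ((0, 1) :: 'a \<times> real) \<noteq> 0"
    by (rule AE_lborel_inner_neq) (simp add: Basis_prod_def)
  ultimately have "AE z in lborel. fourier H z = 0"
    by (auto elim!: eventually_mono)
  then have "AE p in lborel. H p = 0" by (rule fourier_eq_0_imp_AE_eq_0[OF Hi])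
  moreover have "H p = 0 \<longleftrightarrow> D (fst p) (snd p) = 0" for p
    by (auto simp: H_def theta0_cis modulated_gaussian_def split: prod.split)
  ultimately have "AE p in lborel. D (fst p) (snd p) = 0" by simp
  then have "AE p in lborel \<Otimes>\<^sub>M lborel. D (fst p) (snd p) = 0" unfolding lborel_prod .
  then have AE: "AE x in lborel. AE k in lborel. D x k = 0"
    using lborel_pair.AE_pair by fastforce
  have Dx: "continuous_on UNIV (\<lambda>x. D x k)" for k
    using A A' unfolding assumption_A_def D_def by (auto intro!: continuous_intros)
  have Dk: "continuous_on UNIV (\<lambda>k. D x k)" for x
    using A A' unfolding assumption_A_def D_def by (auto intro!: continuous_intros)
  \<comment> \<open>For almost every x, continuity in k removes the exceptional k; with k now fixed,
    continuity in x removes the exceptional x. Joint continuity is never invoked.\<close>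
  have "AE x in lborel. D x k = 0"
    using AE by (rule eventually_mono) (rule continuous_AE_eq_0_imp_eq_0[OF Dk])
  then have "D x k = 0" by (rule continuous_AE_eq_0_imp_eq_0[OF Dx])
  then show ?thesis by (simp add: D_def)
qed

section \<open>Solvability forces class AHa\<close>

lemma solves_P_imp_homogeneous:
  fixes F :: "'a::euclidean_space \<Rightarrow> real \<Rightarrow> real"
  assumes A: "assumption_A F" and N: "solves_P F N" and c: "c \<noteq> 0" and m: "\<bar>m\<bar> = \<bar>c\<bar>"
  shows "F (c *\<^sub>R x) (m * k) = \<bar>c\<bar> * F x k"
proof -
  have m0: "m \<noteq> 0" using c m by auto
  let ?F = "\<lambda>x k. inverse \<bar>c\<bar> * F (c *\<^sub>R x) (m * k)"
  have "F x k = ?F x k"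
  proof (rule pairing_inject[OF A assumption_A_dilate[OF A c m0]])
    fix r :: real and h :: "'a \<Rightarrow> complex" assume r: "r \<noteq> 0" and h: "h \<in> schwartz"
    have P: "pairing F r h = N (\<lambda>w. pairing (tent w) r h)" if "r \<noteq> 0" "h \<in> schwartz" for r h
      using N that unfolding solves_P_pairing by blast
    have "pairing F r h = N (\<lambda>w. pairing (tent w) r h)" by (rule P[OF r h])
    also have "\<dots> = N (\<lambda>w. pairing (tent w) (r / m) (dilate c h))"
      by (simp only: pairing_tent_dilate[OF h c m])
    also have "\<dots> = pairing F (r / m) (dilate c h)"
      using r m0 by (intro P[symmetric] schwartz_dilate h c) simp
    also have "\<dots> = pairing ?F r h"
      by (rule pairing_dilate[OF assumption_A_measurable[OF A] schwartz_measurable[OF h] c m])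
    finally show "pairing F r h = pairing ?F r h" .
  qed
  then show ?thesis using c by simp
qed

text \<open>Equal scalings m = c give homogeneity, the pair c = 1, m = -1 gives evenness in k, and c
  = -1, m = 1 gives evenness in x.\<close>

lemma solves_P_imp_AHa:
  assumes A: "assumption_A F" and N: "solves_P F N"
  shows "AHa F"
  unfolding AHa_def
  using solves_P_imp_homogeneous[OF A N] solves_P_imp_homogeneous[OF A N, of 1 "-1"]
    solves_P_imp_homogeneous[OF A N, of "-1" 1]
  by simp

section \<open>The spanned function at frequency r = 1\<close>

lemma tent_fourier:
  fixes a :: real
  assumes a: "a \<ge> 0"
  shows "(LINT k|lborel. complex_of_real (max 0 (a - \<bar>k\<bar>)) * cis (- k)) = complex_of_real (2 - 2 * cos a)"
proof -
  \<comment> \<open>The value reflects that the second derivative of the tent in k is a unit mass at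
    a and at -a minus twice the unit mass at 0. The computation splits at the kink k = 0 and uses an
    explicit antiderivative on each half; these are differentiated over the complex numbers and then
    restricted to real k.\<close>
  let ?p = "\<lambda>k. complex_of_real (a - k) * cis (- k)" and ?q = "\<lambda>k. complex_of_real (a + k) * cis (- k)"
  have p: "(LINT k|lborel. indicator {0..a} k *\<^sub>R ?p k) =
      (\<i> * complex_of_real (a - a) * cis (- a) - cis (- a)) - (\<i> * complex_of_real (a - 0) * cis (- 0) - cis (- 0))"
  proof (rule integral_FTC_Icc[OF a])
    fix k
    have "((\<lambda>z. \<i> * (complex_of_real a - z) * exp (\<i> * (- z)) - exp (\<i> * (- z))) has_field_derivative ?p k)
        (at (complex_of_real k))"
      by (auto intro!: derivative_eq_intros simp: cis_conv_exp algebra_simps)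
    from has_vector_derivative_real_field[OF this]
    show "((\<lambda>k. \<i> * complex_of_real (a - k) * cis (- k) - cis (- k)) has_vector_derivative ?p k) (at k within {0..a})"
      by (simp add: cis_conv_exp)
  qed (intro continuous_intros)
  have q: "(LINT k|lborel. indicator {- a..0} k *\<^sub>R ?q k) =
      (\<i> * complex_of_real (a + 0) * cis (- 0) + cis (- 0)) - (\<i> * complex_of_real (a + (- a)) * cis (- (- a)) + cis (- (- a)))"
  proof (rule integral_FTC_Icc)
    fix k
    have "((\<lambda>z. \<i> * (complex_of_real a + z) * exp (\<i> * (- z)) + exp (\<i> * (- z))) has_field_derivative ?q k)
        (at (complex_of_real k))"
      by (auto intro!: derivative_eq_intros simp: cis_conv_exp algebra_simps)
    from has_vector_derivative_real_field[OF this]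
    show "((\<lambda>k. \<i> * complex_of_real (a + k) * cis (- k) + cis (- k)) has_vector_derivative ?q k) (at k within {- a..0})"
      by (simp add: cis_conv_exp)
  qed (use a in \<open>auto intro!: continuous_intros\<close>)
  have ip: "integrable lborel (\<lambda>k. indicator {0..a} k *\<^sub>R ?p k)"
    unfolding set_integrable_def[symmetric]
    by (intro borel_integrable_atLeastAtMost' continuous_intros)
  have iq: "integrable lborel (\<lambda>k. indicator {- a..0} k *\<^sub>R ?q k)"
    unfolding set_integrable_def[symmetric]
    by (intro borel_integrable_atLeastAtMost' continuous_intros)
  have "(LINT k|lborel. complex_of_real (max 0 (a - \<bar>k\<bar>)) * cis (- k)) =
      (LINT k|lborel. indicator {0..a} k *\<^sub>R ?p k + indicator {- a..0} k *\<^sub>R ?q k)"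
  proof (rule integral_cong_AE)
    \<comment> \<open>Both closed intervals contain 0, where the sum would count the integrand
      twice, so that point is discarded.\<close>
    show "AE k in lborel. complex_of_real (max 0 (a - \<bar>k\<bar>)) * cis (- k) =
        indicator {0..a} k *\<^sub>R ?p k + indicator {- a..0} k *\<^sub>R ?q k"
      using AE_lborel_singleton[of "0::real"]
      by eventually_elim (auto simp: indicator_def max_def abs_if)
  qed measurable
  also have "\<dots> = complex_of_real (2 - 2 * cos a)"
    unfolding Bochner_Integration.integral_add[OF ip iq] p q
    by (simp add: complex_eq_iff)
  finally show ?thesis .
qed

lemma fourier_lincomb:
  assumes f: "f \<in> schwartz" and g: "g \<in> schwartz"
  shows "fourier (\<lambda>x. a * f x + b * g x) w = a * fourier f w + b * fourier g w"
proof -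
  have i: "integrable lborel (\<lambda>x. f x * cis (- (w \<bullet> x)))" if "f \<in> schwartz" for f
    by (intro integrable_mult_cis schwartz_integrable that) auto
  have "fourier (\<lambda>x. a * f x + b * g x) w =
      (LINT x|lborel. a * (f x * cis (- (w \<bullet> x))) + b * (g x * cis (- (w \<bullet> x))))"
    unfolding fourier_cis by (simp add: algebra_simps)
  also have "\<dots> = a * fourier f w + b * fourier g w"
    unfolding fourier_cis
    by (simp only: Bochner_Integration.integral_add[OF integrable_mult_right[OF i[OF f]] integrable_mult_right[OF i[OF g]]]
        integral_mult_right_zero)
  finally show ?thesis .
qed

lemma inv_fourier_lincomb:
  assumes f: "f \<in> schwartz" and g: "g \<in> schwartz"
  shows "inv_fourier (\<lambda>x. a * f x + b * g x) = (\<lambda>w. a * inv_fourier f w + b * inv_fourier g w)"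
  unfolding inv_fourier_eq_fourier[abs_def] fourier_lincomb[OF f g] by (simp add: algebra_simps)

lemma fourier_uminus:
  assumes "h \<in> schwartz"
  shows "fourier (\<lambda>x. h (- x)) w = fourier h (- w)"
proof -
  have [measurable]: "h \<in> borel_measurable borel" by (rule schwartz_measurable[OF assms])
  have "(LINT x|lborel. h (- x) * cis (- (- w \<bullet> - x))) = (LINT x|lborel. h x * cis (- (- w \<bullet> x)))"
    by (rule lborel_integral_uminus) measurable
  then show ?thesis unfolding fourier_cis by simp
qed

lemma pairing_tent:
  assumes h: "h \<in> schwartz"
  shows "pairing (tent w) 1 h = 2 * fourier h 0 - fourier h w - fourier h (- w)"
proof -
  have i: "integrable lborel (\<lambda>x. h x * cis (- (w \<bullet> x)))" for w
    by (intro integrable_mult_cis schwartz_integrable h) auto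
  have "(LINT k|lborel. complex_of_real (tent w x k) * theta0 1 h x k) =
      2 * (h x * cis (- (0 \<bullet> x))) - h x * cis (- (w \<bullet> x)) - h x * cis (- (- w \<bullet> x))" for x
  proof -
    have "(LINT k|lborel. complex_of_real (tent w x k) * theta0 1 h x k) =
        (LINT k|lborel. (complex_of_real (max 0 (\<bar>w \<bullet> x\<bar> - \<bar>k\<bar>)) * cis (- k)) * h x)"
      by (simp add: tent_def theta0_cis mult.assoc)
    also have "\<dots> = complex_of_real (2 - 2 * cos \<bar>w \<bullet> x\<bar>) * h x"
      by (simp only: integral_mult_left_zero tent_fourier abs_ge_zero)
    also have "cos \<bar>w \<bullet> x\<bar> = cos (w \<bullet> x)" by (simp add: abs_if)
    \<comment> \<open>Splitting the cosine into two plane waves produces the transforms of h at w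
      and at -w, and the constant 2 the one at 0.\<close>
    also have "complex_of_real (2 - 2 * cos (w \<bullet> x)) = 2 - cis (- (w \<bullet> x)) - cis (w \<bullet> x)"
      by (simp add: complex_eq_iff)
    finally show ?thesis by (simp add: algebra_simps)
  qed
  then have "pairing (tent w) 1 h = (LINT x|lborel.
      2 * (h x * cis (- (0 \<bullet> x))) - h x * cis (- (w \<bullet> x)) - h x * cis (- (- w \<bullet> x)))"
    unfolding pairing_def by simp
  also have "\<dots> = 2 * fourier h 0 - fourier h w - fourier h (- w)"
    unfolding fourier_cis
    by (simp only: Bochner_Integration.integral_diff[OF Bochner_Integration.integrable_diff[OF integrable_mult_right[OF i] i] i]
        Bochner_Integration.integral_diff[OF integrable_mult_right[OF i] i] integral_mult_right_zero)
  finally show ?thesis .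
qed

section \<open>The candidate form: existence and uniqueness\<close>

lemma T_F_pairing: "T_F F \<phi> = - (1 / 2) * pairing F 1 (inv_fourier \<phi>)"
  unfolding T_F_def pairing_def fourier_k_def theta0_def
  by (simp add: mult_ac flip: integral_mult_right_zero)

lemma N_F_Sigma:
  fixes F :: "'a::euclidean_space \<Rightarrow> real \<Rightarrow> real"
  assumes "\<phi> \<in> schwartz"
  shows "N_F F (\<lambda>w. \<phi> w - \<phi> 0) = T_F F \<phi>"
proof -
  have "((\<lambda>w. \<phi> w - \<phi> 0) \<longlongrightarrow> 0 - \<phi> 0) at_infinity"
    by (intro tendsto_intros schwartz_tendsto_0 assms)
  then have "Lim at_infinity (\<lambda>w. \<phi> w - \<phi> 0) = 0 - \<phi> 0"
    by (intro tendsto_Lim trivial_limit_at_infinity)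
  then show ?thesis unfolding N_F_def by simp
qed

lemma N_F_linear:
  fixes F :: "'a::euclidean_space \<Rightarrow> real \<Rightarrow> real"
  assumes A: "assumption_A F"
  shows "linear_form_on Sigma_e (N_F F)"
  unfolding linear_form_on_def
proof (intro ballI allI)
  fix f g :: "'a \<Rightarrow> complex" and a b :: complex
  assume "f \<in> Sigma_e" "g \<in> Sigma_e"
  then obtain \<phi> \<psi> where f: "f = (\<lambda>w. \<phi> w - \<phi> 0)" and g: "g = (\<lambda>w. \<psi> w - \<psi> 0)"
    and \<phi>: "\<phi> \<in> schwartz" and \<psi>: "\<psi> \<in> schwartz"
    unfolding Sigma_e_def schwartz_even_def by blast
  let ?\<chi> = "\<lambda>w. a * \<phi> w + b * \<psi> w"
  have "N_F F (\<lambda>w. a * f w + b * g w) = N_F F (\<lambda>w. ?\<chi> w - ?\<chi> 0)"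
    unfolding f g by (simp add: algebra_simps)
  also have "\<dots> = T_F F ?\<chi>" by (rule N_F_Sigma[OF schwartz_lincomb[OF \<phi> \<psi>]])
  also have "\<dots> = a * T_F F \<phi> + b * T_F F \<psi>"
    unfolding T_F_pairing inv_fourier_lincomb[OF \<phi> \<psi>]
      pairing_lincomb[OF A schwartz_inv_fourier[OF \<phi>] schwartz_inv_fourier[OF \<psi>]]
    by (simp add: algebra_simps)
  also have "\<dots> = a * N_F F f + b * N_F F g"
    unfolding f g N_F_Sigma[OF \<phi>] N_F_Sigma[OF \<psi>] ..
  finally show "N_F F (\<lambda>w. a * f w + b * g w) = a * N_F F f + b * N_F F g" .
qed

lemma AHa_pairing_1:
  fixes F :: "'a::euclidean_space \<Rightarrow> real \<Rightarrow> real"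
  assumes A: "assumption_A F" and H: "AHa F" and h: "h \<in> schwartz"
  shows "pairing F 1 h = N_F F (\<lambda>w. pairing (tent w) 1 h)"
proof -
  \<comment> \<open>Minus twice the even part of h, so that the spanned function is the transform of
    e minus its value at 0. As F is even in x, both halves of e pair alike with F, and the resulting
    -2 is cancelled by the -1/2 of \<open>T_F\<close>.\<close>
  define e where "e = (\<lambda>x. (- 1) * h x + (- 1) * h (- x))"
  have hm: "(\<lambda>x. h (- x)) \<in> schwartz" by (rule schwartz_uminus[OF h])
  have e: "e \<in> schwartz" unfolding e_def by (rule schwartz_lincomb[OF h hm])
  have fe: "fourier e w = - fourier h w - fourier h (- w)" for w
    unfolding e_def fourier_lincomb[OF h hm] fourier_uminus[OF h] by simp
  have "(\<lambda>w. pairing (tent w) 1 h) = (\<lambda>w. fourier e w - fourier e 0)"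
    unfolding pairing_tent[OF h] fe by auto
  then have "N_F F (\<lambda>w. pairing (tent w) 1 h) = T_F F (fourier e)"
    using N_F_Sigma[OF schwartz_fourier[OF e]] by simp
  also have "\<dots> = - (1 / 2) * pairing F 1 e"
    unfolding T_F_pairing inv_fourier_fourier[OF e] ..
  also have "pairing F 1 e = - pairing F 1 h - pairing F 1 (\<lambda>x. h (- x))"
    unfolding e_def pairing_lincomb[OF A h hm] by simp
  also have "pairing F 1 (\<lambda>x. h (- x)) = pairing F 1 h"
  proof -
    have "dilate (- 1) h = (\<lambda>x. h (- x))" by (simp add: dilate_def fun_eq_iff)
    then have "pairing F 1 (\<lambda>x. h (- x)) = pairing (\<lambda>x k. F (- x) k) 1 h"
      using pairing_dilate[OF assumption_A_measurable[OF A] schwartz_measurable[OF h], of "-1" 1 1] by simp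
    also have "(\<lambda>x k. F (- x) k) = F" using H unfolding AHa_def by (auto simp: fun_eq_iff)
    finally show ?thesis .
  qed
  finally show ?thesis by simp
qed

lemma AHa_imp_solves_P:
  fixes F :: "'a::euclidean_space \<Rightarrow> real \<Rightarrow> real"
  assumes A: "assumption_A F" and H: "AHa F"
  shows "solves_P F (N_F F)"
  unfolding solves_P_pairing
proof (intro conjI N_F_linear[OF A] allI impI)
  fix r :: real and h :: "'a \<Rightarrow> complex" assume r: "r \<noteq> 0" and h: "h \<in> schwartz"
  have hom: "inverse \<bar>r\<bar> * F (r *\<^sub>R x) (r * k) = F x k" for x k
    using H r unfolding AHa_def by simp
  have "pairing F r h = pairing (\<lambda>x k. inverse \<bar>r\<bar> * F (r *\<^sub>R x) (r * k)) r h"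
    by (simp only: hom)
  also have "\<dots> = pairing F (r / r) (dilate r h)"
    by (rule pairing_dilate[OF assumption_A_measurable[OF A] schwartz_measurable[OF h] r refl, symmetric])
  also have "\<dots> = N_F F (\<lambda>w. pairing (tent w) (r / r) (dilate r h))"
    using AHa_pairing_1[OF A H schwartz_dilate[OF h r]] r by simp
  also have "\<dots> = N_F F (\<lambda>w. pairing (tent w) r h)"
    by (simp only: pairing_tent_dilate[OF h r refl])
  finally show "pairing F r h = N_F F (\<lambda>w. pairing (tent w) r h)" .
qed

text \<open>Every element of \<open>Sigma_e\<close> is itself a spanned function, already at r = 1,
  so the equation prescribes the value of N there.\<close>

lemma solves_P_unique:
  fixes F :: "'a::euclidean_space \<Rightarrow> real \<Rightarrow> real"
  assumes A: "assumption_A F" and N: "solves_P F N" and \<phi>: "\<phi> \<in> schwartz_even"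
  shows "N (\<lambda>w. \<phi> w - \<phi> 0) = T_F F \<phi>"
proof -
  have \<phi>s: "\<phi> \<in> schwartz" and even: "\<phi> (- w) = \<phi> w" for w
    using \<phi> unfolding schwartz_even_def by auto
  let ?g = "inv_fourier \<phi>"
  \<comment> \<open>The transform of this function is -phi/2, and evenness of phi adds the
    contributions of w and -w to phi(w). The zero summand only matches the shape of the linear
    combination lemmas.\<close>
  let ?h = "\<lambda>x. - (1 / 2) * ?g x + 0 * ?g x"
  have g: "?g \<in> schwartz" by (rule schwartz_inv_fourier[OF \<phi>s])
  have h: "?h \<in> schwartz" by (rule schwartz_lincomb[OF g g])
  have "fourier ?h w = - (1 / 2) * \<phi> w" for w
    unfolding fourier_lincomb[OF g g] fourier_inv_fourier[OF \<phi>s] by simp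
  then have "(\<lambda>w. pairing (tent w) 1 ?h) = (\<lambda>w. \<phi> w - \<phi> 0)"
    unfolding pairing_tent[OF h] by (auto simp: even)
  moreover have "pairing F 1 ?h = N (\<lambda>w. pairing (tent w) 1 ?h)"
  proof -
    have "\<forall>r h. r \<noteq> 0 \<longrightarrow> h \<in> schwartz \<longrightarrow> pairing F r h = N (\<lambda>w. pairing (tent w) r h)"
      using N unfolding solves_P_pairing by (rule conjunct2)
    from this[rule_format, OF one_neq_zero h] show ?thesis .
  qed
  ultimately show ?thesis
    unfolding T_F_pairing pairing_lincomb[OF A g g] by simp
qed

text \<open>Uniqueness is expressed by the values at phi - phi(0), since a total function N is
  unconstrained outside \<open>Sigma_e\<close>.\<close>

theorem mainTheorem1:
  fixes F :: "'a::euclidean_space \<Rightarrow> real \<Rightarrow> real"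
  assumes "assumption_A F"
  shows "((\<exists>N. solves_P F N) \<longleftrightarrow> AHa F) \<and>
         (AHa F \<longrightarrow> solves_P F (N_F F) \<and>
           (\<forall>N. solves_P F N \<longrightarrow>
              (\<forall>\<phi>\<in>schwartz_even. N (\<lambda>w. \<phi> w - \<phi> 0) =
                 - (1/2) * (LINT x|lborel. inv_fourier \<phi> x *
                     (LINT k|lborel. complex_of_real (F x k) * exp (- \<i> * complex_of_real k))))))"
proof (intro conjI iffI impI allI ballI)
  show "AHa F" if "\<exists>N. solves_P F N"
    using that solves_P_imp_AHa[OF assms] by blast
  show "\<exists>N. solves_P F N" if "AHa F"
    using AHa_imp_solves_P[OF assms that] by blast
  show "solves_P F (N_F F)" if "AHa F"
    by (rule AHa_imp_solves_P[OF assms that])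
  fix N and \<phi> :: "'a \<Rightarrow> complex" assume "solves_P F N" "\<phi> \<in> schwartz_even"
  then have "N (\<lambda>w. \<phi> w - \<phi> 0) = T_F F \<phi>" by (rule solves_P_unique[OF assms])
  then show "N (\<lambda>w. \<phi> w - \<phi> 0) = - (1/2) * (LINT x|lborel. inv_fourier \<phi> x *
                     (LINT k|lborel. complex_of_real (F x k) * exp (- \<i> * complex_of_real k)))"
    unfolding T_F_def fourier_k_def by simp
qed

end
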